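(* For every metric measure space $\mathfrak X$ exactly one of the following holds: (A) the spaces ${\rm BMO}^p(\mathfrak X)$, $p\in[1,\infty)$, all coincide; (B) there is $p_0\in(1,\infty)$ such that for distinct $p_1,p_2\in[1,\infty)$ the spaces ${\rm BMO}^{p_1}(\mathfrak X)$ and ${\rm BMO}^{p_2}(\mathfrak X)$ coincide if and only if $\max\{p_1,p_2\}<p_0$; (C) there is $p_0\in[1,\infty)$ such that for distinct $p_1,p_2\in[1,\infty)$ the spaces ${\rm BMO}^{p_1}(\mathfrak X)$ and ${\rm BMO}^{p_2}(\mathfrak X)$ coincide if and only if $\max\{p_1,p_2\}\le p_0$. Conversely, each of (A), (B) for every $p_0\in(1,\infty)$, and (C) for every $p_0\in[1,\infty)$, is realized by some metric measure space $\mathfrak X$.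
   Context: A metric measure space is $(X,\rho,\mu)$ with $X$ nonempty, $\rho$ a metric, $\mu$ a nonnegative Borel measure. For locally integrable $f$ and an open ball $B$ with $\mu(B)\in(0,\infty)$, $f_B=\mu(B)^{-1}\int_Bf\,d\mu$. For $p\in[1,\infty)$, ${\rm BMO}^p(\mathfrak X)$ consists of locally integrable $f$ with $\|f\|_{*,p}=\sup_B\big(\mu(B)^{-1}\int_B|f-f_B|^pd\mu\big)^{1/p}<\infty$, the supremum over open balls $B$ with $\mu(B)\in(0,\infty)$; functions differing by a constant are identified. "Coincide" means equal as sets of functions. *)

theory Defs
  imports "HOL-Analysis.Analysis"
begin

text \<open>A metric measure space (X, rho, mu): X nonempty, rho a metric on X,
  mu a (nonnegative) measure on X whose sigma-algebra is the Borel sigma-algebra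
  of the metric topology of (X, rho).\<close>
definition mm_space :: "'a set \<Rightarrow> ('a \<Rightarrow> 'a \<Rightarrow> real) \<Rightarrow> 'a measure \<Rightarrow> bool" where
  "mm_space X \<rho> \<mu> \<longleftrightarrow> X \<noteq> {} \<and> Metric_space X \<rho> \<and> space \<mu> = X \<and>
     sets \<mu> = sigma_sets X {U. openin (Metric_space.mtopology X \<rho>) U}"

text \<open>Open balls B(x,r) with centre x in X and radius r > 0.\<close>
definition open_balls :: "'a set \<Rightarrow> ('a \<Rightarrow> 'a \<Rightarrow> real) \<Rightarrow> 'a set set" where
  "open_balls X \<rho> = {Metric_space.mball X \<rho> x r | x r. x \<in> X \<and> r > 0}"

text \<open>Balls B with 0 < mu(B) < infinity (those over which the BMO supremum ranges).\<close>
definition good_balls :: "'a set \<Rightarrow> ('a \<Rightarrow> 'a \<Rightarrow> real) \<Rightarrow> 'a measure \<Rightarrow> 'a set set" where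
  "good_balls X \<rho> \<mu> = {B \<in> open_balls X \<rho>. 0 < emeasure \<mu> B \<and> emeasure \<mu> B < \<infinity>}"

text \<open>Local integrability: integrable over every open ball of finite measure.\<close>
definition loc_integrable :: "'a set \<Rightarrow> ('a \<Rightarrow> 'a \<Rightarrow> real) \<Rightarrow> 'a measure \<Rightarrow> ('a \<Rightarrow> real) \<Rightarrow> bool" where
  "loc_integrable X \<rho> \<mu> f \<longleftrightarrow>
     (\<forall>B \<in> open_balls X \<rho>. emeasure \<mu> B < \<infinity> \<longrightarrow> set_integrable \<mu> B f)"

text \<open>Mean value f_B.\<close>
definition ball_avg :: "'a measure \<Rightarrow> ('a \<Rightarrow> real) \<Rightarrow> 'a set \<Rightarrow> real" where
  "ball_avg \<mu> f B = (LINT x:B|\<mu>. f x) / measure \<mu> B"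

text \<open>p-th power of the BMO^p oscillation over B:
  mu(B)^{-1} \<integral>_B |f - f_B|^p dmu (as an extended nonnegative real).\<close>
definition bmo_osc :: "'a measure \<Rightarrow> real \<Rightarrow> ('a \<Rightarrow> real) \<Rightarrow> 'a set \<Rightarrow> ennreal" where
  "bmo_osc \<mu> p f B =
     (\<integral>\<^sup>+ x \<in> B. ennreal (\<bar>f x - ball_avg \<mu> f B\<bar> powr p) \<partial>\<mu>) / emeasure \<mu> B"

text \<open>BMO^p as a set of functions: locally integrable f with
  ||f||_{*,p}^p = sup over good balls of the oscillation finite.
  (Finiteness of ||f||_{*,p} is equivalent to finiteness of its p-th power.)\<close>
definition BMO :: "'a set \<Rightarrow> ('a \<Rightarrow> 'a \<Rightarrow> real) \<Rightarrow> 'a measure \<Rightarrow> real \<Rightarrow> ('a \<Rightarrow> real) set" where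
  "BMO X \<rho> \<mu> p = {f. loc_integrable X \<rho> \<mu> f \<and>
      (SUP B \<in> good_balls X \<rho> \<mu>. bmo_osc \<mu> p f B) < \<infinity>}"

definition caseA :: "'a set \<Rightarrow> ('a \<Rightarrow> 'a \<Rightarrow> real) \<Rightarrow> 'a measure \<Rightarrow> bool" where
  "caseA X \<rho> \<mu> \<longleftrightarrow> (\<forall>p1 p2. 1 \<le> p1 \<longrightarrow> 1 \<le> p2 \<longrightarrow> BMO X \<rho> \<mu> p1 = BMO X \<rho> \<mu> p2)"

definition caseB :: "'a set \<Rightarrow> ('a \<Rightarrow> 'a \<Rightarrow> real) \<Rightarrow> 'a measure \<Rightarrow> real \<Rightarrow> bool" where
  "caseB X \<rho> \<mu> p0 \<longleftrightarrow> 1 < p0 \<and>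
     (\<forall>p1 p2. 1 \<le> p1 \<longrightarrow> 1 \<le> p2 \<longrightarrow> p1 \<noteq> p2 \<longrightarrow>
        (BMO X \<rho> \<mu> p1 = BMO X \<rho> \<mu> p2 \<longleftrightarrow> max p1 p2 < p0))"

definition caseC :: "'a set \<Rightarrow> ('a \<Rightarrow> 'a \<Rightarrow> real) \<Rightarrow> 'a measure \<Rightarrow> real \<Rightarrow> bool" where
  "caseC X \<rho> \<mu> p0 \<longleftrightarrow> 1 \<le> p0 \<and>
     (\<forall>p1 p2. 1 \<le> p1 \<longrightarrow> 1 \<le> p2 \<longrightarrow> p1 \<noteq> p2 \<longrightarrow>
        (BMO X \<rho> \<mu> p1 = BMO X \<rho> \<mu> p2 \<longleftrightarrow> max p1 p2 \<le> p0))"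

end

theory Submission
  imports Defs "HOL-Real_Asymp.Real_Asymp"
begin

text \<open>The spaces decrease in the exponent. If \<open>BMO p1 = BMO p2\<close> for some \<open>p1 < p2\<close>, then applying this
  to Hoelder functions of an \<open>f \<in> BMO r\<close>, \<open>r \<le> p1\<close>, improves \<open>f\<close> to \<open>BMO (r * p2 / p1)\<close>; iterating
  from \<open>r = 1\<close> gives \<open>BMO 1 = BMO p2\<close>. So everything is governed by the set of \<open>p\<close> with
  \<open>BMO p = BMO 1\<close>, which is an interval containing 1: unbounded, half-open or closed.

  For the converse, on a weighted infinite path whose only balls are small neighbourhoods and the
  whole space, \<open>BMO 1\<close> consists of the Lipschitz functions, and \<open>BMO p = BMO 1\<close> exactly when the
  weights \<open>w\<close> have a finite \<open>p\<close>-th moment. Exponential weights, the weights \<open>n powr (- 1 - p0)\<close>, and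
  the latter divided by a squared logarithm realize the three cases.\<close>

text \<open>Equality of two spaces as sets does not by itself give an inequality between their
  oscillations. It only says that each single function of \<open>BMO p1\<close> has
  \<open>p2\<close>-oscillations bounded over all balls, with a bound depending on that function.
  The functions that would give the improvement are the peaks
  \<open>\<bar>x - f\<^sub>B\<bar> powr s\<close> composed with \<open>f\<close>; their centre moves
  with the ball, so no single one of them serves all balls. The gliding hump merges them into one
  function and takes the place of a closed graph argument with its need for completeness. Peaks are
  \<open>s\<close>-Hoelder only because the \<open>s\<close>-th power is subadditive for
  \<open>s \<le> 1\<close>, which is why improvement is available only up to \<open>p1\<close>. Each
  application multiplies the exponent by the fixed factor \<open>p2 / p1 > 1\<close>, so finitely
  many suffice. In the examples the two kinds of balls have separate tasks: the small ones fix the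
  local regularity in the same way for every exponent, and the whole space sees only the tail of the
  weights.\<close>

lemma powr_abs_add_le:
  fixes a b p :: real
  assumes "0 \<le> p"
  shows "\<bar>a + b\<bar> powr p \<le> 2 powr p * (\<bar>a\<bar> powr p + \<bar>b\<bar> powr p)"
proof -
  let ?m = "max \<bar>a\<bar> \<bar>b\<bar>"
  have "\<bar>a + b\<bar> powr p \<le> (2 * ?m) powr p"
    using assms by (intro powr_mono2) auto
  also have "\<dots> = 2 powr p * ?m powr p"
    by (simp add: powr_mult)
  also have "\<dots> \<le> 2 powr p * (\<bar>a\<bar> powr p + \<bar>b\<bar> powr p)"
    by (intro mult_left_mono) (auto simp: max_def)
  finally show ?thesis .
qed

text \<open>A pointwise substitute for Jensen's inequality. Only finiteness of oscillations matters,
  so the additive 1 costs nothing.\<close>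

lemma powr_le_one_add_powr:
  fixes x p q :: real
  assumes "0 \<le> x" "0 \<le> p" "p \<le> q"
  shows "x powr p \<le> 1 + x powr q"
proof (cases "x \<le> 1")
  case True
  then have "x powr p \<le> 1" using assms by (intro powr_le1) auto
  then show ?thesis using powr_ge_zero[of x q] by linarith
next
  case False
  then have "x powr p \<le> x powr q" using assms by (intro powr_mono) auto
  then show ?thesis by simp
qed

section \<open>Hoelder functions of a real variable and their superposition\<close>

definition holder :: "real \<Rightarrow> real \<Rightarrow> (real \<Rightarrow> real) \<Rightarrow> bool" where
  "holder s L \<phi> \<longleftrightarrow> (\<forall>x y. \<bar>\<phi> x - \<phi> y\<bar> \<le> L * \<bar>x - y\<bar> powr s)"

lemma holderD: "holder s L \<phi> \<Longrightarrow> \<bar>\<phi> x - \<phi> y\<bar> \<le> L * \<bar>x - y\<bar> powr s"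
  by (simp add: holder_def)

lemma holder_mono: "holder s L \<phi> \<Longrightarrow> L \<le> M \<Longrightarrow> holder s M \<phi>"
  by (meson holder_def mult_right_mono order_trans powr_ge_zero)

lemma holder_const_nonneg: "holder s L \<phi> \<Longrightarrow> 0 \<le> L"
  using holderD[of s L \<phi> 1 0] by simp

lemma holder_add:
  assumes "holder s L \<phi>" "holder s M \<psi>"
  shows "holder s (L + M) (\<lambda>x. \<phi> x + \<psi> x)"
  unfolding holder_def
proof (intro allI)
  fix x y
  show "\<bar>\<phi> x + \<psi> x - (\<phi> y + \<psi> y)\<bar> \<le> (L + M) * \<bar>x - y\<bar> powr s"
    using holderD[OF assms(1), of x y] holderD[OF assms(2), of x y] unfolding distrib_right by linarith
qed

lemma holder_scale: "holder s L \<phi> \<Longrightarrow> holder s (\<bar>a\<bar> * L) (\<lambda>x. a * \<phi> x)"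
  unfolding holder_def by (simp flip: right_diff_distrib add: abs_mult mult.assoc mult_left_mono)

lemma holder_minus: "holder s L \<phi> \<Longrightarrow> holder s L (\<lambda>x. - \<phi> x)"
  using holder_scale[of s L \<phi> "-1"] by simp

text \<open>Dividing by \<open>a + b\<close> puts both terms into [0, 1], where
  \<open>t \<le> t powr s\<close> for \<open>s \<le> 1\<close>.\<close>

lemma powr_subadd:
  fixes a b s :: real
  assumes "0 < s" "s \<le> 1" "0 \<le> a" "0 \<le> b"
  shows "(a + b) powr s \<le> a powr s + b powr s"
proof (cases "a + b = 0")
  case True
  then show ?thesis using assms by simp
next
  case False
  let ?t = "a + b"
  have t: "?t > 0" using False assms by auto
  have *: "x / ?t \<le> (x / ?t) powr s" if "0 \<le> x" "x \<le> ?t" for x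
    using powr_mono'[of s 1 "x / ?t"] that t assms by simp
  have "1 = a / ?t + b / ?t" using t by (simp flip: add_divide_distrib)
  also have "\<dots> \<le> (a / ?t) powr s + (b / ?t) powr s"
    using assms by (intro add_mono *) auto
  also have "\<dots> = (a powr s + b powr s) / ?t powr s"
    using assms by (simp add: powr_divide add_divide_distrib)
  finally show ?thesis using t by (simp add: field_simps)
qed

text \<open>These are the peaks. Composed with \<open>f\<close> and compared at the centre
  \<open>c\<close>, such a function has \<open>p\<close>-oscillation exactly the
  \<open>s * p\<close>-oscillation of \<open>f\<close> about \<open>c\<close>. The shift
  \<open>d\<close> is left free so that a peak can be made to vanish at 0.\<close>

lemma holder_dist_powr:
  assumes "0 < s" "s \<le> 1"
  shows "holder s 1 (\<lambda>x. \<bar>x - c\<bar> powr s - d)"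
proof -
  have *: "\<bar>x - c\<bar> powr s \<le> \<bar>y - c\<bar> powr s + \<bar>x - y\<bar> powr s" for x y
  proof -
    have "\<bar>x - c\<bar> powr s \<le> (\<bar>y - c\<bar> + \<bar>x - y\<bar>) powr s"
      using assms by (intro powr_mono2) auto
    also have "\<dots> \<le> \<bar>y - c\<bar> powr s + \<bar>x - y\<bar> powr s"
      using assms by (intro powr_subadd) auto
    finally show ?thesis .
  qed
  show ?thesis unfolding holder_def
  proof (intro allI)
    fix x y
    show "\<bar>\<bar>x - c\<bar> powr s - d - (\<bar>y - c\<bar> powr s - d)\<bar> \<le> 1 * \<bar>x - y\<bar> powr s"
      using *[of x y] *[of y x] by (simp add: abs_minus_commute abs_le_iff)
  qed
qed

lemma holder_continuous:
  assumes "holder s L \<phi>" "0 < s"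
  shows "continuous_on UNIV \<phi>"
proof -
  have "(\<phi> \<longlongrightarrow> \<phi> y) (at y)" for y
  proof (rule LIM_zero_cancel, rule Lim_null_comparison)
    show "\<forall>\<^sub>F x in at y. norm (\<phi> x - \<phi> y) \<le> L * \<bar>x - y\<bar> powr s"
      using holderD[OF assms(1)] by simp
    have "((\<lambda>x. L * \<bar>x - y\<bar> powr s) \<longlongrightarrow> L * \<bar>y - y\<bar> powr s) (at y)"
      using assms(2) by (intro tendsto_intros) auto
    then show "((\<lambda>x. L * \<bar>x - y\<bar> powr s) \<longlongrightarrow> 0) (at y)" using assms(2) by simp
  qed
  then show ?thesis by (simp add: continuous_on_def)
qed

lemma holder_suminf:
  fixes d :: "nat \<Rightarrow> real \<Rightarrow> real"
  assumes d: "\<And>k. holder s (l k) (d k)" and l: "summable l" and sm: "\<And>x. summable (\<lambda>k. d k x)"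
  shows "holder s (suminf l) (\<lambda>x. \<Sum>k. d k x)"
  unfolding holder_def
proof (intro allI)
  fix x y
  have "summable (\<lambda>k. l k * \<bar>x - y\<bar> powr s)" using l by (rule summable_mult2)
  have "\<bar>\<Sum>k. d k x - d k y\<bar> \<le> (\<Sum>k. l k * \<bar>x - y\<bar> powr s)"
    using holderD[OF d, of _ x y] \<open>summable (\<lambda>k. l k * \<bar>x - y\<bar> powr s)\<close>
    by (intro norm_suminf_le[where 'a = real, unfolded real_norm_def]) auto
  then show "\<bar>(\<Sum>k. d k x) - (\<Sum>k. d k y)\<bar> \<le> suminf l * \<bar>x - y\<bar> powr s"
    using suminf_diff[OF sm sm] suminf_mult2[OF l] by simp
qed

text \<open>The peaks are superposed with geometrically decreasing coefficients. At each step the sign of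
  the new peak is chosen so that it does not cancel against what has been built so far: one of the
  two signs works because \<open>2 \<xi> = (g + \<xi>) - (g - \<xi>)\<close>. The remaining tail is too small to spoil it.\<close>

lemma gliding_hump:
  fixes A :: "nat \<Rightarrow> (real \<Rightarrow> real) \<Rightarrow> real" and E c :: "nat \<Rightarrow> real"
  assumes s: "0 < s" "s \<le> 1" and p: "1 \<le> p"
    and sub: "\<And>k \<phi> \<psi> L M. holder s L \<phi> \<Longrightarrow> holder s M \<psi> \<Longrightarrow>
      A k (\<lambda>x. \<phi> x + \<psi> x) \<le> 2 powr p * (A k \<phi> + A k \<psi>)"
    and neg: "\<And>k \<phi>. A k (\<lambda>x. - \<phi> x) = A k \<phi>"
    and bnd: "\<And>k \<phi> L. holder s L \<phi> \<Longrightarrow> A k \<phi> \<le> L powr p * E k"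
    and peak: "\<And>k a. 0 \<le> a \<Longrightarrow>
      A k (\<lambda>x. a * (\<bar>x - c k\<bar> powr s - \<bar>c k\<bar> powr s)) = a powr p * E k"
    and E: "\<And>k. real k * 2 powr (p + 2) * 16 powr (real k * p) \<le> E k"
  obtains \<psi> where "holder s 2 \<psi>" "\<And>k. real k \<le> A k \<psi>"
proof -
  \<comment> \<open>The powers \<open>a k powr p\<close> equal \<open>16 powr (- (k * p))\<close>,
    exactly the factor that the growth of \<open>E\<close> has to outweigh. The ratio 16 makes the
    later coefficients small against \<open>a k\<close>.\<close>
  define a where "a k = (1 / 16 :: real) ^ k" for k
  have a_pos: "a k > 0" for k by (simp add: a_def)
  have a_powr: "a k powr p = 16 powr (- (real k * p))" for k
  proof -
    have "a k = 16 powr (- real k)"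
      by (simp add: a_def powr_minus powr_realpow power_one_over inverse_eq_divide)
    then show ?thesis by (simp add: powr_powr)
  qed
  \<comment> \<open>Subtracting \<open>\<bar>c k\<bar> powr s\<close> makes every peak vanish at 0.
    The Hoelder bound then dominates the k-th term by \<open>a k * \<bar>x\<bar> powr s\<close>, so
    the superposition converges everywhere, however far out the centres lie.\<close>
  define \<xi> where "\<xi> k x = a k * (\<bar>x - c k\<bar> powr s - \<bar>c k\<bar> powr s)" for k x
  have \<xi>: "holder s (a k) (\<xi> k)" "\<xi> k 0 = 0" for k
    using holder_scale[OF holder_dist_powr[OF s, of "c k" "\<bar>c k\<bar> powr s"], of "a k"] a_pos[of k]
    by (simp_all add: \<xi>_def[abs_def])
  have E0: "0 \<le> E k" for k using E[of k] by (rule order_trans[rotated]) auto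
  define Q where "Q n g h \<longleftrightarrow> (h = (\<lambda>x. g x + \<xi> n x) \<or> h = (\<lambda>x. g x + - \<xi> n x)) \<and>
      a n powr p * E n \<le> 2 * A n h" for n g h
  have "\<exists>g. \<forall>n. ((n = 0 \<longrightarrow> g n = (\<lambda>_. 0)) \<and> (\<exists>L. holder s L (g n))) \<and> Q n (g n) (g (Suc n))"
  proof (rule dependent_nat_choice)
    show "\<exists>g. (0 = (0::nat) \<longrightarrow> g = (\<lambda>_. 0)) \<and> (\<exists>L. holder s L g)"
      by (auto simp: holder_def intro!: exI[of _ 0])
  next
    fix g and n :: nat
    assume "(n = 0 \<longrightarrow> g = (\<lambda>_. 0)) \<and> (\<exists>L. holder s L g)"
    then obtain L where L: "holder s L g" by blast
    have h1: "holder s (L + a n) (\<lambda>x. g x + \<xi> n x)" and h2: "holder s (L + a n) (\<lambda>x. g x + - \<xi> n x)"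
      using holder_add[OF L \<xi>(1)] holder_add[OF L holder_minus[OF \<xi>(1)]] .
    \<comment> \<open>The factor \<open>2 powr p\<close> gained by doubling the peak cancels the one
      lost in \<open>sub\<close>, so one of the two signs keeps at least half of the full
      peak.\<close>
    have "2 powr p * (a n powr p * E n) = A n (\<lambda>x. 2 * a n * (\<bar>x - c n\<bar> powr s - \<bar>c n\<bar> powr s))"
      using a_pos[of n] by (subst peak) (simp_all add: powr_mult)
    also have "(\<lambda>x. 2 * a n * (\<bar>x - c n\<bar> powr s - \<bar>c n\<bar> powr s)) =
        (\<lambda>x. (g x + \<xi> n x) + - (g x + - \<xi> n x))"
      by (simp add: \<xi>_def algebra_simps)
    also have "A n \<dots> \<le> 2 powr p * (A n (\<lambda>x. g x + \<xi> n x) + A n (\<lambda>x. g x + - \<xi> n x))"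
      using sub[OF h1 holder_minus[OF h2]] unfolding neg .
    finally have "a n powr p * E n \<le> A n (\<lambda>x. g x + \<xi> n x) + A n (\<lambda>x. g x + - \<xi> n x)"
      by simp
    then have "a n powr p * E n \<le> 2 * A n (\<lambda>x. g x + \<xi> n x) \<or> a n powr p * E n \<le> 2 * A n (\<lambda>x. g x + - \<xi> n x)"
      by linarith
    then show "\<exists>h. ((Suc n = 0 \<longrightarrow> h = (\<lambda>_. 0)) \<and> (\<exists>L. holder s L h)) \<and> Q n g h"
      unfolding Q_def using h1 h2 by blast
  qed
  then obtain g where g0: "g 0 = (\<lambda>_. 0)" and gh: "\<And>n. \<exists>L. holder s L (g n)" and Q: "\<And>n. Q n (g n) (g (Suc n))"
    by blast
  define d where "d n x = g (Suc n) x - g n x" for n x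
  have "d n = \<xi> n \<or> d n = (\<lambda>x. - \<xi> n x)" for n
    using Q[of n] by (auto simp: Q_def d_def fun_eq_iff)
  then have d: "holder s (a n) (d n)" "d n 0 = 0" for n
    using \<xi>[of n] holder_minus[OF \<xi>(1)[of n]] by (metis, metis neg_equal_0_iff_equal)
  have suma: "summable a" unfolding a_def by (rule summable_geometric) simp
  have sumd: "summable (\<lambda>n. d n x)" for x
  proof (rule summable_comparison_test')
    show "summable (\<lambda>n. a n * \<bar>x\<bar> powr s)" using suma by (rule summable_mult2)
    show "norm (d n x) \<le> a n * \<bar>x\<bar> powr s" if "n \<ge> 0" for n
      using holderD[OF d(1), of n x 0] d(2)[of n] by simp
  qed
  define \<psi> where "\<psi> x = (\<Sum>n. d n x)" for x
  have tail: "\<psi> x - g m x = (\<Sum>n. d (n + m) x)" for m x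
  proof -
    have "(\<Sum>n<m. d n x) = g m x"
      using sum_lessThan_telescope[of "\<lambda>n. g n x" m] by (simp add: d_def g0)
    then show ?thesis using suminf_split_initial_segment[OF sumd, of x m] by (simp add: \<psi>_def)
  qed
  have suma_tail: "(\<Sum>n. a (n + m)) = a m * (16 / 15)" for m
  proof -
    have "(\<Sum>n. a (n + m)) = (\<Sum>n. a m * (1/16)^n)" by (simp add: a_def power_add mult.commute)
    also have "\<dots> = a m * (16/15)" by (subst suminf_mult) (auto simp: suminf_geometric summable_geometric)
    finally show ?thesis .
  qed
  have tail_holder: "holder s (a m * (16 / 15)) (\<lambda>x. \<psi> x - g m x)" for m
    unfolding tail suma_tail[symmetric]
    by (intro holder_suminf d(1) summable_ignore_initial_segment[OF suma]
        summable_ignore_initial_segment[OF sumd])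
  show ?thesis
  proof (rule that[of \<psi>])
    have "holder s (a 0 * (16 / 15)) \<psi>" using tail_holder[of 0] by (simp add: g0)
    then show \<psi>: "holder s 2 \<psi>" by (rule holder_mono) (simp add: a_def)
    fix k :: nat
    \<comment> \<open>The exact constant is \<open>a k / 15\<close>. It is rounded to 1/8 because
      \<open>8 powr (- p)\<close> splits into \<open>2 powr (- p)\<close>, which pays for the next
      use of \<open>sub\<close>, and \<open>4 powr (- p) \<le> 1 / 4\<close>, which leaves half of
      the hump intact.\<close>
    have "a (Suc k) * (16 / 15) \<le> a k / 8" by (simp add: a_def)
    with tail_holder[of "Suc k"] have L: "holder s (a k / 8) (\<lambda>x. \<psi> x - g (Suc k) x)"
      by (rule holder_mono)
    have "A k (\<lambda>x. \<psi> x - g (Suc k) x) \<le> (a k / 8) powr p * E k"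
      using L by (rule bnd)
    also have "\<dots> = (a k powr p * E k) * (2 powr (- p) * 4 powr (- p))"
      using powr_mult[of 2 4 "-p"] by (simp add: powr_divide powr_minus field_simps)
    also have "\<dots> \<le> (a k powr p * E k) * (2 powr (- p) * (1 / 4))"
    proof (intro mult_left_mono)
      show "4 powr (- p) \<le> (1/4 :: real)"
        using powr_mono[of "-p" "-1" "4::real"] p by simp
    qed (use E0 in auto)
    finally have tl: "A k (\<lambda>x. \<psi> x - g (Suc k) x) \<le> (a k powr p * E k) * 2 powr (- p) / 4"
      by simp
    have "a k powr p * E k / 2 \<le> A k (g (Suc k))" using Q[of k] by (simp add: Q_def)
    also have "g (Suc k) = (\<lambda>x. \<psi> x + - (\<psi> x - g (Suc k) x))" by simp
    also have "A k \<dots> \<le> 2 powr p * (A k \<psi> + A k (\<lambda>x. \<psi> x - g (Suc k) x))"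
      using sub[OF \<psi> holder_minus[OF L]] unfolding neg .
    finally have "a k powr p * E k / 2 / 2 powr p \<le> A k \<psi> + A k (\<lambda>x. \<psi> x - g (Suc k) x)"
      by (simp add: field_simps)
    with tl have "a k powr p * E k * 2 powr (- p) / 4 \<le> A k \<psi>"
      by (simp add: powr_minus field_simps)
    moreover have "real k = a k powr p * (real k * 2 powr (p + 2) * 16 powr (real k * p)) * 2 powr (- p) / 4"
      unfolding a_powr by (simp add: powr_add powr_minus field_simps)
    moreover have "\<dots> \<le> a k powr p * E k * 2 powr (- p) / 4"
      using E[of k] by (intro divide_right_mono mult_right_mono mult_left_mono) auto
    ultimately show "real k \<le> A k \<psi>" by linarith
  qed
qed

section \<open>Normalized means over a finite measure\<close>

text \<open>Taken in \<open>ennreal\<close>, so that an infinite oscillation is a legitimate value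
  and finiteness can be a conclusion. Negative values of \<open>F\<close> count as 0.\<close>

definition mean_nn :: "'a measure \<Rightarrow> ('a \<Rightarrow> real) \<Rightarrow> ennreal" where
  "mean_nn R F = (\<integral>\<^sup>+x. ennreal (F x) \<partial>R) / emeasure R (space R)"

text \<open>The abstract form of a good ball carrying the restricted measure.\<close>

locale pos_finite_measure = finite_measure +
  assumes emeasure_space_pos: "0 < emeasure M (space M)"
begin

lemma emeasure_space_cases: "emeasure M (space M) \<noteq> 0" "emeasure M (space M) \<noteq> top"
  using emeasure_space_pos emeasure_finite by auto

lemma measure_space_pos: "0 < measure M (space M)"
  using emeasure_space_pos by (simp add: emeasure_eq_measure)

lemma mean_nn_const: "mean_nn M (\<lambda>_. c) = ennreal c"
  unfolding mean_nn_def using emeasure_space_cases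
  by (simp add: ennreal_mult_divide_eq)

lemma mean_nn_cmult:
  assumes "0 \<le> b" "F \<in> borel_measurable M"
  shows "mean_nn M (\<lambda>x. b * F x) = ennreal b * mean_nn M F"
  unfolding mean_nn_def using assms
  by (simp add: ennreal_mult' nn_integral_cmult ennreal_times_divide)

lemma mean_nn_lincomb_le:
  assumes "\<And>x. x \<in> space M \<Longrightarrow> F x \<le> b * G x + c * H x"
    and nonneg: "\<And>x. 0 \<le> G x" "\<And>x. 0 \<le> H x" "0 \<le> b" "0 \<le> c"
    and [measurable]: "G \<in> borel_measurable M" "H \<in> borel_measurable M"
  shows "mean_nn M F \<le> ennreal b * mean_nn M G + ennreal c * mean_nn M H"
proof -
  have "(\<integral>\<^sup>+x. ennreal (F x) \<partial>M) \<le> (\<integral>\<^sup>+x. ennreal b * ennreal (G x) + ennreal c * ennreal (H x) \<partial>M)"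
  proof (rule nn_integral_mono)
    fix x assume "x \<in> space M"
    then have "ennreal (F x) \<le> ennreal (b * G x + c * H x)" using assms(1) by (intro ennreal_leI)
    also have "\<dots> = ennreal b * ennreal (G x) + ennreal c * ennreal (H x)"
      using nonneg by (simp add: ennreal_mult)
    finally show "ennreal (F x) \<le> \<dots>" .
  qed
  also have "\<dots> = ennreal b * (\<integral>\<^sup>+x. ennreal (G x) \<partial>M) + ennreal c * (\<integral>\<^sup>+x. ennreal (H x) \<partial>M)"
    by (simp add: nn_integral_add nn_integral_cmult)
  finally have "mean_nn M F \<le>
      (ennreal b * (\<integral>\<^sup>+x. ennreal (G x) \<partial>M) + ennreal c * (\<integral>\<^sup>+x. ennreal (H x) \<partial>M)) / emeasure M (space M)"
    unfolding mean_nn_def by (rule divide_right_mono_ennreal)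
  then show ?thesis
    by (simp add: mean_nn_def add_divide_distrib_ennreal ennreal_times_divide)
qed

lemma mean_nn_affine_le:
  assumes "\<And>x. x \<in> space M \<Longrightarrow> F x \<le> a + b * G x" "\<And>x. 0 \<le> G x" "0 \<le> a" "0 \<le> b" "0 \<le> A"
    and "G \<in> borel_measurable M" "mean_nn M G \<le> ennreal A"
  shows "mean_nn M F \<le> ennreal (a + b * A)"
proof -
  have "mean_nn M F \<le> ennreal b * mean_nn M G + ennreal a * mean_nn M (\<lambda>_. 1)"
    using assms by (intro mean_nn_lincomb_le) (auto simp: add.commute)
  also have "\<dots> \<le> ennreal b * ennreal A + ennreal a * 1"
    using assms(7) by (intro add_mono mult_left_mono) (auto simp: mean_nn_const)
  also have "\<dots> = ennreal (a + b * A)"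
    using assms by (simp add: ennreal_mult add.commute)
  finally show ?thesis .
qed

lemma abs_avg_diff_le_mean_nn:
  fixes f :: "'a \<Rightarrow> real"
  assumes "integrable M f"
  shows "ennreal \<bar>(\<integral>x. f x \<partial>M) / measure M (space M) - c\<bar> \<le> mean_nn M (\<lambda>x. \<bar>f x - c\<bar>)"
proof -
  let ?m = "measure M (space M)"
  have "(\<integral>x. f x \<partial>M) / ?m - c = (\<integral>x. f x - c \<partial>M) / ?m"
    using assms measure_space_pos by (simp add: field_simps)
  then have "\<bar>(\<integral>x. f x \<partial>M) / ?m - c\<bar> = \<bar>\<integral>x. f x - c \<partial>M\<bar> / ?m"
    by simp
  also have "\<dots> \<le> (\<integral>x. \<bar>f x - c\<bar> \<partial>M) / ?m"
    using assms by (intro divide_right_mono integral_abs_bound) auto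
  finally have "ennreal \<bar>(\<integral>x. f x \<partial>M) / ?m - c\<bar> \<le> ennreal ((\<integral>x. \<bar>f x - c\<bar> \<partial>M) / ?m)"
    by (rule ennreal_leI)
  also have "\<dots> = mean_nn M (\<lambda>x. \<bar>f x - c\<bar>)"
    using assms measure_space_pos
    by (simp add: mean_nn_def nn_integral_eq_integral emeasure_eq_measure divide_ennreal)
  finally show ?thesis .
qed

text \<open>Allows the mean value to be traded for any centre at bounded distance. This is essential
  under nonlinear maps, where the image of a mean is not the mean of the image.\<close>

lemma mean_nn_recenter:
  assumes [measurable]: "f \<in> borel_measurable M" and "0 \<le> p" "0 \<le> A"
    and "mean_nn M (\<lambda>x. \<bar>f x - c\<bar> powr p) \<le> ennreal A" "\<bar>c - d\<bar> \<le> D"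
  shows "mean_nn M (\<lambda>x. \<bar>f x - d\<bar> powr p) \<le> ennreal (2 powr p * D powr p + 2 powr p * A)"
proof (rule mean_nn_affine_le)
  fix x
  have "\<bar>f x - d\<bar> powr p \<le> 2 powr p * (\<bar>f x - c\<bar> powr p + \<bar>c - d\<bar> powr p)"
    using powr_abs_add_le[OF assms(2), of "f x - c" "c - d"] by simp
  also have "\<dots> \<le> 2 powr p * (\<bar>f x - c\<bar> powr p + D powr p)"
    using assms by (intro mult_left_mono add_left_mono powr_mono2) auto
  finally show "\<bar>f x - d\<bar> powr p \<le> 2 powr p * D powr p + 2 powr p * \<bar>f x - c\<bar> powr p"
    by (simp add: algebra_simps)
qed (use assms in auto)

lemma mean_nn_powr_mono:
  assumes [measurable]: "f \<in> borel_measurable M" and "0 \<le> p" "p \<le> q" "0 \<le> A"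
    and "mean_nn M (\<lambda>x. \<bar>f x - c\<bar> powr q) \<le> ennreal A"
  shows "mean_nn M (\<lambda>x. \<bar>f x - c\<bar> powr p) \<le> ennreal (1 + A)"
  using mean_nn_affine_le[of "\<lambda>x. \<bar>f x - c\<bar> powr p" 1 1 "\<lambda>x. \<bar>f x - c\<bar> powr q" A] assms
  by (simp add: powr_le_one_add_powr)

lemma abs_avg_diff_le:
  fixes f :: "'a \<Rightarrow> real"
  assumes "integrable M f" "1 \<le> p" "0 \<le> A" "mean_nn M (\<lambda>x. \<bar>f x - c\<bar> powr p) \<le> ennreal A"
  shows "\<bar>(\<integral>x. f x \<partial>M) / measure M (space M) - c\<bar> \<le> 1 + A"
proof -
  have "ennreal \<bar>(\<integral>x. f x \<partial>M) / measure M (space M) - c\<bar> \<le> mean_nn M (\<lambda>x. \<bar>f x - c\<bar> powr 1)"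
    using abs_avg_diff_le_mean_nn[OF assms(1)] by simp
  also have "\<dots> \<le> ennreal (1 + A)"
    using assms by (intro mean_nn_powr_mono[of _ _ p]) auto
  finally show ?thesis using assms by (simp del: ennreal_plus)
qed

end

section \<open>Balls as finite measures, and BMO with arbitrary centres\<close>

lemma open_balls_sets:
  assumes "mm_space X \<rho> \<mu>" "B \<in> open_balls X \<rho>"
  shows "B \<in> sets \<mu>"
proof -
  have "openin (Metric_space.mtopology X \<rho>) B"
    using assms by (auto simp: mm_space_def open_balls_def Metric_space.openin_mball)
  then have "B \<in> sigma_sets X {U. openin (Metric_space.mtopology X \<rho>) U}"
    by (intro sigma_sets.Basic) simp
  then show ?thesis using assms by (simp add: mm_space_def)
qed

lemma good_ball_restrict:
  assumes "mm_space X \<rho> \<mu>" "B \<in> good_balls X \<rho> \<mu>"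
  shows "pos_finite_measure (restrict_space \<mu> B)" "space (restrict_space \<mu> B) = B"
    "B \<in> sets \<mu>"
proof -
  show B: "B \<in> sets \<mu>" using assms open_balls_sets[OF assms(1)] by (auto simp: good_balls_def)
  show sp: "space (restrict_space \<mu> B) = B" using sets.sets_into_space[OF B] by (auto simp: space_restrict_space)
  have em: "emeasure (restrict_space \<mu> B) B = emeasure \<mu> B" using B by (simp add: emeasure_restrict_space)
  show "pos_finite_measure (restrict_space \<mu> B)"
    using assms(2)
    by (intro pos_finite_measure.intro finite_measureI pos_finite_measure_axioms.intro)
      (auto simp: sp em good_balls_def)
qed

lemma loc_integrable_restrict:
  assumes "mm_space X \<rho> \<mu>" "loc_integrable X \<rho> \<mu> f" "B \<in> good_balls X \<rho> \<mu>"
  shows "integrable (restrict_space \<mu> B) f"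
proof -
  have "set_integrable \<mu> B f"
    using assms(2,3) by (simp add: loc_integrable_def good_balls_def)
  then show ?thesis
    using good_ball_restrict(3)[OF assms(1,3)] by (subst (asm) set_integrable_eq) auto
qed

lemma ball_avg_restrict:
  assumes "B \<in> sets \<mu>"
  shows "ball_avg \<mu> f B = (\<integral>x. f x \<partial>restrict_space \<mu> B) / measure (restrict_space \<mu> B) (space (restrict_space \<mu> B))"
proof -
  have B: "B \<inter> space \<mu> = B" using sets.sets_into_space[OF assms] by blast
  show ?thesis
    using assms
    by (simp add: ball_avg_def set_lebesgue_integral_def integral_restrict_space space_restrict_space
        measure_restrict_space B)
qed

lemma bmo_osc_restrict:
  assumes "B \<in> sets \<mu>"
  shows "bmo_osc \<mu> p f B = mean_nn (restrict_space \<mu> B) (\<lambda>x. \<bar>f x - ball_avg \<mu> f B\<bar> powr p)"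
proof -
  have B: "B \<inter> space \<mu> = B" using sets.sets_into_space[OF assms] by blast
  show ?thesis
    using assms
    by (simp add: bmo_osc_def mean_nn_def nn_integral_restrict_space space_restrict_space
        emeasure_restrict_space B)
qed

lemma BMO_iff:
  "f \<in> BMO X \<rho> \<mu> p \<longleftrightarrow> loc_integrable X \<rho> \<mu> f \<and>
     (\<exists>K\<ge>0. \<forall>B\<in>good_balls X \<rho> \<mu>. bmo_osc \<mu> p f B \<le> ennreal K)"
proof -
  have "(SUP B \<in> good_balls X \<rho> \<mu>. bmo_osc \<mu> p f B) < \<infinity> \<longleftrightarrow>
      (\<exists>K\<ge>0. \<forall>B\<in>good_balls X \<rho> \<mu>. bmo_osc \<mu> p f B \<le> ennreal K)" (is "?S < \<infinity> \<longleftrightarrow> ?R")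
  proof
    assume "?S < \<infinity>"
    then obtain K where "K \<ge> 0" "?S = ennreal K" by (cases ?S) auto
    then show ?R by (metis SUP_upper)
  next
    assume ?R
    then obtain K where "\<forall>B\<in>good_balls X \<rho> \<mu>. bmo_osc \<mu> p f B \<le> ennreal K" by blast
    then have "?S \<le> ennreal K" by (intro SUP_least) auto
    also have "\<dots> < \<infinity>" by simp
    finally show "?S < \<infinity>" .
  qed
  then show ?thesis by (simp add: BMO_def)
qed

text \<open>A bound about an arbitrary centre \<open>c B\<close> confines the mean to within
  \<open>1 + A\<close> of it, and recentring then costs a constant independent of the ball. Centres
  chosen later are \<open>\<phi> (f\<^sub>B)\<close> and values of \<open>f\<close> at a
  point.\<close>

lemma BMO_I:
  assumes mm: "mm_space X \<rho> \<mu>" and f: "loc_integrable X \<rho> \<mu> f" and p: "1 \<le> p" and A: "0 \<le> A"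
    and c: "\<And>B. B \<in> good_balls X \<rho> \<mu> \<Longrightarrow>
      mean_nn (restrict_space \<mu> B) (\<lambda>x. \<bar>f x - c B\<bar> powr p) \<le> ennreal A"
  shows "f \<in> BMO X \<rho> \<mu> p"
  unfolding BMO_iff
proof (intro conjI f exI ballI)
  show "0 \<le> 2 powr p * (1 + A) powr p + 2 powr p * A" using A by simp
next
  fix B assume B: "B \<in> good_balls X \<rho> \<mu>"
  interpret pos_finite_measure "restrict_space \<mu> B" using good_ball_restrict[OF mm B] by simp
  note int = loc_integrable_restrict[OF mm f B]
  have "\<bar>ball_avg \<mu> f B - c B\<bar> \<le> 1 + A"
    using abs_avg_diff_le[OF int p A c[OF B]] good_ball_restrict(3)[OF mm B] by (simp add: ball_avg_restrict)
  then show "bmo_osc \<mu> p f B \<le> ennreal (2 powr p * (1 + A) powr p + 2 powr p * A)"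
    unfolding bmo_osc_restrict[OF good_ball_restrict(3)[OF mm B]]
    using mean_nn_recenter[OF _ _ A c[OF B], of "ball_avg \<mu> f B" "1 + A"] int p
    by (simp add: abs_minus_commute)
qed

lemma BMO_D:
  assumes mm: "mm_space X \<rho> \<mu>" and f: "f \<in> BMO X \<rho> \<mu> p"
  obtains A where "0 \<le> A" "\<And>B. B \<in> good_balls X \<rho> \<mu> \<Longrightarrow>
    mean_nn (restrict_space \<mu> B) (\<lambda>x. \<bar>f x - ball_avg \<mu> f B\<bar> powr p) \<le> ennreal A"
proof -
  obtain A where "0 \<le> A" and A: "\<forall>B\<in>good_balls X \<rho> \<mu>. bmo_osc \<mu> p f B \<le> ennreal A"
    using f unfolding BMO_iff by blast
  show ?thesis
  proof (rule that[OF \<open>0 \<le> A\<close>])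
    fix B assume B: "B \<in> good_balls X \<rho> \<mu>"
    with A have "bmo_osc \<mu> p f B \<le> ennreal A" by blast
    then show "mean_nn (restrict_space \<mu> B) (\<lambda>x. \<bar>f x - ball_avg \<mu> f B\<bar> powr p) \<le> ennreal A"
      by (simp only: bmo_osc_restrict[OF good_ball_restrict(3)[OF mm B]])
  qed
qed

lemma BMO_antimono:
  assumes mm: "mm_space X \<rho> \<mu>" and "1 \<le> p" "p \<le> q"
  shows "BMO X \<rho> \<mu> q \<subseteq> BMO X \<rho> \<mu> p"
proof
  fix f assume f: "f \<in> BMO X \<rho> \<mu> q"
  then have loc: "loc_integrable X \<rho> \<mu> f" by (simp add: BMO_iff)
  obtain A where A: "0 \<le> A" "\<And>B. B \<in> good_balls X \<rho> \<mu> \<Longrightarrow>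
    mean_nn (restrict_space \<mu> B) (\<lambda>x. \<bar>f x - ball_avg \<mu> f B\<bar> powr q) \<le> ennreal A"
    using BMO_D[OF mm f] by blast
  show "f \<in> BMO X \<rho> \<mu> p"
  proof (rule BMO_I[OF mm loc \<open>1 \<le> p\<close>, where A = "1 + A"])
    fix B assume B: "B \<in> good_balls X \<rho> \<mu>"
    interpret pos_finite_measure "restrict_space \<mu> B" using good_ball_restrict[OF mm B] by simp
    show "mean_nn (restrict_space \<mu> B) (\<lambda>x. \<bar>f x - ball_avg \<mu> f B\<bar> powr p) \<le> ennreal (1 + A)"
      using loc_integrable_restrict[OF mm loc B] A(2)[OF B] A(1) assms by (intro mean_nn_powr_mono[of _ _ q]) auto
  qed (use A in auto)
qed

section \<open>Composition of BMO functions with Hoelder functions\<close>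

text \<open>A Hoelder function with exponent at most 1 grows at most linearly, and constants are
  integrable over a ball of finite measure. Balls of measure zero count here as well, so the
  restricted measure is only known to be finite.\<close>

lemma holder_comp_loc_integrable:
  assumes f: "loc_integrable X \<rho> \<mu> f" and mm: "mm_space X \<rho> \<mu>"
    and \<phi>: "holder s L \<phi>" and s: "0 < s" "s \<le> 1"
  shows "loc_integrable X \<rho> \<mu> (\<lambda>x. \<phi> (f x))"
  unfolding loc_integrable_def
proof (intro ballI impI)
  fix B assume B: "B \<in> open_balls X \<rho>" "emeasure \<mu> B < \<infinity>"
  have Bs: "B \<in> sets \<mu>" using open_balls_sets[OF mm B(1)] .
  have Bsp: "B \<subseteq> space \<mu>" using sets.sets_into_space[OF Bs] .
  interpret finite_measure "restrict_space \<mu> B"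
    using B Bs Bsp by (intro finite_measureI) (simp add: space_restrict_space emeasure_restrict_space Int_absorb2)
  have int: "integrable (restrict_space \<mu> B) f"
    using f B Bs by (subst set_integrable_eq[symmetric]) (auto simp: loc_integrable_def)
  have "integrable (restrict_space \<mu> B) (\<lambda>x. \<phi> (f x))"
  proof (rule Bochner_Integration.integrable_bound)
    show "integrable (restrict_space \<mu> B) (\<lambda>x. \<bar>\<phi> 0\<bar> + L * (1 + \<bar>f x\<bar>))"
      using int by auto
    have "\<phi> \<in> borel_measurable borel"
      using holder_continuous[OF \<phi> s(1)] by (rule borel_measurable_continuous_onI)
    then show "(\<lambda>x. \<phi> (f x)) \<in> borel_measurable (restrict_space \<mu> B)"
      using int by measurable
    have "norm (\<phi> y) \<le> norm (\<bar>\<phi> 0\<bar> + L * (1 + \<bar>y\<bar>))" for y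
    proof -
      have "\<bar>\<phi> y - \<phi> 0\<bar> \<le> L * \<bar>y\<bar> powr s" using holderD[OF \<phi>, of y 0] by simp
      also have "\<dots> \<le> L * (1 + \<bar>y\<bar>)"
        using powr_le_one_add_powr[of "\<bar>y\<bar>" s 1] s holder_const_nonneg[OF \<phi>] by (intro mult_left_mono) auto
      finally have "\<bar>\<phi> y\<bar> \<le> \<bar>\<phi> 0\<bar> + L * (1 + \<bar>y\<bar>)" by linarith
      then show ?thesis unfolding real_norm_def by linarith
    qed
    then show "AE x in restrict_space \<mu> B. norm (\<phi> (f x)) \<le> norm (\<bar>\<phi> 0\<bar> + L * (1 + \<bar>f x\<bar>))"
      by simp
  qed
  then show "set_integrable \<mu> B (\<lambda>x. \<phi> (f x))"
    using Bs by (subst set_integrable_eq) auto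
qed

lemma (in pos_finite_measure) mean_nn_holder_comp_le:
  assumes [measurable]: "f \<in> borel_measurable M" and \<phi>: "holder s L \<phi>" and p: "0 \<le> p"
  shows "mean_nn M (\<lambda>x. \<bar>\<phi> (f x) - \<phi> c\<bar> powr p) \<le> ennreal (L powr p) * mean_nn M (\<lambda>x. \<bar>f x - c\<bar> powr (s * p))"
proof -
  have "mean_nn M (\<lambda>x. \<bar>\<phi> (f x) - \<phi> c\<bar> powr p) \<le>
      ennreal (L powr p) * mean_nn M (\<lambda>x. \<bar>f x - c\<bar> powr (s * p)) + ennreal 0 * mean_nn M (\<lambda>_. 0)"
  proof (rule mean_nn_lincomb_le)
    fix x
    have "\<bar>\<phi> (f x) - \<phi> c\<bar> powr p \<le> (L * \<bar>f x - c\<bar> powr s) powr p"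
      using holderD[OF \<phi>] p by (intro powr_mono2) auto
    then show "\<bar>\<phi> (f x) - \<phi> c\<bar> powr p \<le> L powr p * \<bar>f x - c\<bar> powr (s * p) + 0 * 0"
      by (simp add: powr_mult powr_powr)
  qed auto
  then show ?thesis by simp
qed

context
  fixes X :: "'a set" and \<rho> \<mu> f and r s L :: real and \<phi>
  assumes mm: "mm_space X \<rho> \<mu>" and f: "f \<in> BMO X \<rho> \<mu> r"
    and \<phi>: "holder s L \<phi>" and s: "0 < s" "s \<le> 1" and r: "1 \<le> r"
begin

lemma holder_comp_BMO:
  assumes "1 \<le> p" "s * p = r"
  shows "(\<lambda>x. \<phi> (f x)) \<in> BMO X \<rho> \<mu> p"
proof -
  have loc: "loc_integrable X \<rho> \<mu> f" using f by (simp add: BMO_iff)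
  obtain A where A: "0 \<le> A" "\<And>B. B \<in> good_balls X \<rho> \<mu> \<Longrightarrow>
    mean_nn (restrict_space \<mu> B) (\<lambda>x. \<bar>f x - ball_avg \<mu> f B\<bar> powr r) \<le> ennreal A"
    using BMO_D[OF mm f] by blast
  show ?thesis
  proof (rule BMO_I[OF mm holder_comp_loc_integrable[OF loc mm \<phi> s] \<open>1 \<le> p\<close>, where A = "L powr p * A"])
    fix B assume B: "B \<in> good_balls X \<rho> \<mu>"
    interpret pos_finite_measure "restrict_space \<mu> B" using good_ball_restrict[OF mm B] by simp
    have "mean_nn (restrict_space \<mu> B) (\<lambda>x. \<bar>\<phi> (f x) - \<phi> (ball_avg \<mu> f B)\<bar> powr p) \<le>
        ennreal (L powr p) * mean_nn (restrict_space \<mu> B) (\<lambda>x. \<bar>f x - ball_avg \<mu> f B\<bar> powr (s * p))"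
      using loc_integrable_restrict[OF mm loc B] \<phi> assms(1) by (intro mean_nn_holder_comp_le) auto
    also have "\<dots> \<le> ennreal (L powr p) * ennreal A"
      unfolding assms(2) by (intro mult_left_mono A(2)[OF B]) simp
    finally show "mean_nn (restrict_space \<mu> B) (\<lambda>x. \<bar>\<phi> (f x) - \<phi> (ball_avg \<mu> f B)\<bar> powr p) \<le> ennreal (L powr p * A)"
      using A(1) by (simp add: ennreal_mult)
  qed (use A in auto)
qed

text \<open>Moves the centre from the mean of \<open>\<phi> \<circ> f\<close> to
  \<open>\<phi> (f\<^sub>B)\<close>. Their distance is at most \<open>L\<close> times the
  \<open>s\<close>-oscillation of \<open>f\<close>, which is bounded over the balls because
  \<open>s \<le> 1 \<le> r\<close>. About the new centre the Hoelder estimate applies pointwise, and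
  peaks at \<open>f\<^sub>B\<close> attain it.\<close>

lemma holder_comp_BMO_D:
  assumes "1 \<le> p" "(\<lambda>x. \<phi> (f x)) \<in> BMO X \<rho> \<mu> p"
  obtains K where "0 \<le> K" "\<And>B. B \<in> good_balls X \<rho> \<mu> \<Longrightarrow>
    mean_nn (restrict_space \<mu> B) (\<lambda>x. \<bar>\<phi> (f x) - \<phi> (ball_avg \<mu> f B)\<bar> powr p) \<le> ennreal K"
proof -
  have loc: "loc_integrable X \<rho> \<mu> f" using f by (simp add: BMO_iff)
  note loc' = holder_comp_loc_integrable[OF loc mm \<phi> s]
  obtain A where A: "0 \<le> A" "\<And>B. B \<in> good_balls X \<rho> \<mu> \<Longrightarrow>
    mean_nn (restrict_space \<mu> B) (\<lambda>x. \<bar>f x - ball_avg \<mu> f B\<bar> powr r) \<le> ennreal A"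
    using BMO_D[OF mm f] by blast
  obtain K where K: "0 \<le> K" "\<And>B. B \<in> good_balls X \<rho> \<mu> \<Longrightarrow>
    mean_nn (restrict_space \<mu> B) (\<lambda>x. \<bar>\<phi> (f x) - ball_avg \<mu> (\<lambda>x. \<phi> (f x)) B\<bar> powr p) \<le> ennreal K"
    using BMO_D[OF mm assms(2)] by blast
  show ?thesis
  proof (rule that)
    show "0 \<le> 2 powr p * (L * (1 + A)) powr p + 2 powr p * K" using K by simp
    fix B assume B: "B \<in> good_balls X \<rho> \<mu>"
    interpret pos_finite_measure "restrict_space \<mu> B" using good_ball_restrict[OF mm B] by simp
    note int = loc_integrable_restrict[OF mm loc B] and int' = loc_integrable_restrict[OF mm loc' B]
    have "ennreal \<bar>ball_avg \<mu> (\<lambda>x. \<phi> (f x)) B - \<phi> (ball_avg \<mu> f B)\<bar>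
        \<le> mean_nn (restrict_space \<mu> B) (\<lambda>x. \<bar>\<phi> (f x) - \<phi> (ball_avg \<mu> f B)\<bar> powr 1)"
      unfolding ball_avg_restrict[OF good_ball_restrict(3)[OF mm B], of "\<lambda>x. \<phi> (f x)"]
      using abs_avg_diff_le_mean_nn[OF int'] by simp
    also have "\<dots> \<le> ennreal (L powr 1) * mean_nn (restrict_space \<mu> B) (\<lambda>x. \<bar>f x - ball_avg \<mu> f B\<bar> powr (s * 1))"
      using int \<phi> by (intro mean_nn_holder_comp_le) auto
    also have "\<dots> \<le> ennreal (L powr 1) * ennreal (1 + A)"
      using int s r A by (intro mult_left_mono mean_nn_powr_mono[of _ _ r] A(2)[OF B]) auto
    also have "\<dots> = ennreal (L * (1 + A))"
      using holder_const_nonneg[OF \<phi>] A by (simp add: ennreal_mult)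
    finally have "\<bar>ball_avg \<mu> (\<lambda>x. \<phi> (f x)) B - \<phi> (ball_avg \<mu> f B)\<bar> \<le> L * (1 + A)"
      using holder_const_nonneg[OF \<phi>] A by (subst (asm) ennreal_le_iff) auto
    then show "mean_nn (restrict_space \<mu> B) (\<lambda>x. \<bar>\<phi> (f x) - \<phi> (ball_avg \<mu> f B)\<bar> powr p)
        \<le> ennreal (2 powr p * (L * (1 + A)) powr p + 2 powr p * K)"
      using int' assms(1) K(1) K(2)[OF B] by (intro mean_nn_recenter[where c = "ball_avg \<mu> (\<lambda>x. \<phi> (f x)) B"]) auto
  qed
qed

end

text \<open>With \<open>s = r / p1\<close>, composing \<open>f \<in> BMO r\<close> with an \<open>s\<close>-Hoelder function gives an element of
  \<open>BMO p1\<close>. Were the \<open>p2\<close>-oscillations of \<open>|f - f\<^sub>B|\<close> to the power \<open>s\<close> unbounded over the balls \<open>B\<close>,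
  a gliding hump would produce a single \<open>s\<close>-Hoelder \<open>\<psi>\<close> with \<open>\<psi> \<circ> f\<close> in \<open>BMO p1\<close> but not in \<open>BMO p2\<close>.\<close>

lemma BMO_self_improvement:
  assumes mm: "mm_space X \<rho> \<mu>" and r: "1 \<le> r" "r \<le> p1" and p: "p1 \<le> p2"
    and sub: "BMO X \<rho> \<mu> p1 \<subseteq> BMO X \<rho> \<mu> p2"
  shows "BMO X \<rho> \<mu> r \<subseteq> BMO X \<rho> \<mu> (r * p2 / p1)"
proof (rule subsetI, rule ccontr)
  fix f assume f: "f \<in> BMO X \<rho> \<mu> r" and nf: "f \<notin> BMO X \<rho> \<mu> (r * p2 / p1)"
  define s where "s = r / p1"
  have s: "0 < s" "s \<le> 1" "s * p1 = r" "s * p2 = r * p2 / p1" using r by (auto simp: s_def)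
  have p12: "1 \<le> p1" "1 \<le> p2" using r p by auto
  have loc: "loc_integrable X \<rho> \<mu> f" using f by (simp add: BMO_iff)
  define R where "R B = restrict_space \<mu> B" for B
  define c where "c B = ball_avg \<mu> f B" for B
  \<comment> \<open>For each fixed \<open>\<phi>\<close> the bound is uniform over the balls, but
    \<open>K\<close> depends on \<open>\<phi>\<close>. The contradiction will come from a single
    \<open>\<phi>\<close>.\<close>
  have bounded: "\<exists>K\<ge>0. \<forall>B\<in>good_balls X \<rho> \<mu>. mean_nn (R B) (\<lambda>x. \<bar>\<phi> (f x) - \<phi> (c B)\<bar> powr p2) \<le> ennreal K"
    if \<phi>: "holder s L \<phi>" for \<phi> L
  proof -
    have "(\<lambda>x. \<phi> (f x)) \<in> BMO X \<rho> \<mu> p1"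
      by (rule holder_comp_BMO[OF mm f \<phi> s(1,2) r(1) p12(1) s(3)])
    then have "(\<lambda>x. \<phi> (f x)) \<in> BMO X \<rho> \<mu> p2" using sub by blast
    from holder_comp_BMO_D[OF mm f \<phi> s(1,2) r(1) p12(2) this] show ?thesis
      unfolding R_def c_def by metis
  qed
  define osc where "osc B = mean_nn (R B) (\<lambda>x. \<bar>f x - c B\<bar> powr (s * p2))" for B
  \<comment> \<open>One peak centred at the mean over \<open>B\<close> is bounded over all balls,
    and the bound is used at \<open>B\<close> itself. Finiteness matters because
    \<open>enn2real\<close> sends infinity to 0 and would hide the growth.\<close>
  have osc_fin: "osc B < \<infinity>" if "B \<in> good_balls X \<rho> \<mu>" for B
  proof -
    obtain K where K: "\<forall>B'\<in>good_balls X \<rho> \<mu>. mean_nn (R B')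
        (\<lambda>x. \<bar>\<bar>f x - c B\<bar> powr s - 0 - (\<bar>c B' - c B\<bar> powr s - 0)\<bar> powr p2) \<le> ennreal K"
      using bounded[OF holder_dist_powr[OF s(1,2), of "c B" 0]] by (elim exE conjE)
    have "mean_nn (R B) (\<lambda>x. \<bar>\<bar>f x - c B\<bar> powr s - 0 - (\<bar>c B - c B\<bar> powr s - 0)\<bar> powr p2) \<le> ennreal K"
      by (rule bspec[OF K that])
    then have "osc B \<le> ennreal K" by (simp add: osc_def powr_powr)
    also have "\<dots> < \<infinity>" by simp
    finally show ?thesis .
  qed
  have "\<exists>B\<in>good_balls X \<rho> \<mu>. ennreal K < osc B" if "0 \<le> K" for K
  proof (rule ccontr)
    assume "\<not> ?thesis"
    then have "\<forall>B\<in>good_balls X \<rho> \<mu>. bmo_osc \<mu> (r * p2 / p1) f B \<le> ennreal K"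
      using good_ball_restrict(3)[OF mm]
      by (simp add: bmo_osc_restrict not_less osc_def R_def c_def s(4))
    then show False using nf loc that unfolding BMO_iff by blast
  qed
  \<comment> \<open>The oscillations exceed every real number, so balls can be picked at whatever
    rate the gliding hump demands.\<close>
  then have "\<forall>k::nat. \<exists>B\<in>good_balls X \<rho> \<mu>. ennreal (real k * 2 powr (p2 + 2) * 16 powr (real k * p2)) < osc B"
    by simp
  then obtain B where B: "\<And>k. B k \<in> good_balls X \<rho> \<mu>"
    and B_big: "\<And>k::nat. ennreal (real k * 2 powr (p2 + 2) * 16 powr (real k * p2)) < osc (B k)"
    by metis
  define m where "m k \<phi> = mean_nn (R (B k)) (\<lambda>x. \<bar>\<phi> (f x) - \<phi> (c (B k))\<bar> powr p2)" for k \<phi>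
  have pf: "pos_finite_measure (R (B k))" and meas: "f \<in> borel_measurable (R (B k))" for k
    using good_ball_restrict(1)[OF mm B, of k] loc_integrable_restrict[OF mm loc B, of k]
    by (auto simp: R_def)
  have comp_meas: "(\<lambda>x. \<phi> (f x)) \<in> borel_measurable (R (B k))" if "holder s L \<phi>" for k L \<phi>
    using loc_integrable_restrict[OF mm holder_comp_loc_integrable[OF loc mm that s(1,2)] B, of k]
    by (simp add: R_def borel_measurable_integrable)
  have m_fin: "m k \<phi> < \<infinity>" if \<phi>: "holder s L \<phi>" for k L \<phi>
  proof -
    obtain K where "m k \<phi> \<le> ennreal K" using bounded[OF \<phi>] B[of k] unfolding m_def by blast
    also have "\<dots> < \<infinity>" by simp
    finally show ?thesis .
  qed
  define E where "E k = enn2real (osc (B k))" for k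
  have E: "osc (B k) = ennreal (E k)" for k using osc_fin[OF B[of k]] by (simp add: E_def)
  have E0: "0 \<le> E k" for k by (simp add: E_def)
  have m_peak: "m k (\<lambda>x. a * (\<bar>x - c (B k)\<bar> powr s - \<bar>c (B k)\<bar> powr s)) = ennreal (a powr p2 * E k)"
    if "0 \<le> a" for k a
  proof -
    interpret pos_finite_measure "R (B k)" by (rule pf)
    have "m k (\<lambda>x. a * (\<bar>x - c (B k)\<bar> powr s - \<bar>c (B k)\<bar> powr s)) =
        mean_nn (R (B k)) (\<lambda>x. a powr p2 * \<bar>f x - c (B k)\<bar> powr (s * p2))"
    proof -
      have "a * (\<bar>y - c (B k)\<bar> powr s - \<bar>c (B k)\<bar> powr s) -
          a * (\<bar>c (B k) - c (B k)\<bar> powr s - \<bar>c (B k)\<bar> powr s) = a * \<bar>y - c (B k)\<bar> powr s" for y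
        by (simp add: right_diff_distrib)
      then show ?thesis using that unfolding m_def by (simp only: abs_mult) (simp add: powr_mult powr_powr)
    qed
    also have "\<dots> = ennreal (a powr p2) * osc (B k)"
      using meas[of k] by (subst mean_nn_cmult) (auto simp: osc_def)
    finally show ?thesis using E0 by (simp add: E ennreal_mult)
  qed
  obtain \<psi> where \<psi>: "holder s 2 \<psi>" and \<psi>_big: "\<And>k. real k \<le> enn2real (m k \<psi>)"
  proof (rule gliding_hump[OF s(1,2) p12(2), where A = "\<lambda>k \<phi>. enn2real (m k \<phi>)" and E = E and c = "\<lambda>k. c (B k)"])
    fix k \<phi> \<phi>' L L' assume h: "holder s L \<phi>" "holder s L' \<phi>'"
    interpret pos_finite_measure "R (B k)" by (rule pf)
    have "m k (\<lambda>x. \<phi> x + \<phi>' x) \<le> ennreal (2 powr p2) * m k \<phi> + ennreal (2 powr p2) * m k \<phi>'"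
      unfolding m_def
    proof (rule mean_nn_lincomb_le)
      fix x
      show "\<bar>\<phi> (f x) + \<phi>' (f x) - (\<phi> (c (B k)) + \<phi>' (c (B k)))\<bar> powr p2
         \<le> 2 powr p2 * \<bar>\<phi> (f x) - \<phi> (c (B k))\<bar> powr p2 + 2 powr p2 * \<bar>\<phi>' (f x) - \<phi>' (c (B k))\<bar> powr p2"
        using powr_abs_add_le[of p2 "\<phi> (f x) - \<phi> (c (B k))" "\<phi>' (f x) - \<phi>' (c (B k))"] p12
        by (simp add: algebra_simps)
    qed (use comp_meas[OF h(1), of k] comp_meas[OF h(2), of k] in auto)
    also have "\<dots> = ennreal (2 powr p2 * (enn2real (m k \<phi>) + enn2real (m k \<phi>')))"
      using m_fin[OF h(1), of k] m_fin[OF h(2), of k]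
      by (simp add: ennreal_mult distrib_left)
    finally have "enn2real (m k (\<lambda>x. \<phi> x + \<phi>' x)) \<le> enn2real \<dots>"
      by (rule enn2real_mono) simp
    then show "enn2real (m k (\<lambda>x. \<phi> x + \<phi>' x)) \<le> 2 powr p2 * (enn2real (m k \<phi>) + enn2real (m k \<phi>'))"
      by simp
  next
    fix k \<phi>
    show "enn2real (m k (\<lambda>x. - \<phi> x)) = enn2real (m k \<phi>)"
      by (simp add: m_def abs_minus_commute)
  next
    fix k \<phi> L assume h: "holder s L \<phi>"
    interpret pos_finite_measure "R (B k)" by (rule pf)
    have "m k \<phi> \<le> ennreal (L powr p2) * osc (B k)"
      unfolding m_def osc_def using meas[of k] h p12 by (intro mean_nn_holder_comp_le) auto
    also have "\<dots> = ennreal (L powr p2 * E k)" using E0 by (simp add: E ennreal_mult)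
    finally have "enn2real (m k \<phi>) \<le> enn2real (ennreal (L powr p2 * E k))" by (rule enn2real_mono) simp
    then show "enn2real (m k \<phi>) \<le> L powr p2 * E k" using E0 by simp
  next
    fix k a assume "0 \<le> (a::real)"
    then show "enn2real (m k (\<lambda>x. a * (\<bar>x - c (B k)\<bar> powr s - \<bar>c (B k)\<bar> powr s))) = a powr p2 * E k"
      using E0 by (simp add: m_peak)
  next
    fix k
    show "real k * 2 powr (p2 + 2) * 16 powr (real k * p2) \<le> E k"
      using less_imp_le[OF B_big[of k]] E0[of k] unfolding E by (subst (asm) ennreal_le_iff) auto
  next
    fix g assume "holder s 2 g" "\<And>k. real k \<le> enn2real (m k g)"
    then show thesis by (rule that)
  qed
  \<comment> \<open>The composition of \<open>f\<close> with the single function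
    \<open>\<psi>\<close> has bounded \<open>p2\<close>-oscillations about the centres
    \<open>\<psi> (c B)\<close>, while the one over \<open>B k\<close> is at least
    \<open>k\<close>.\<close>
  obtain K where K: "0 \<le> K" "\<And>k. m k \<psi> \<le> ennreal K"
    using bounded[OF \<psi>] B unfolding m_def by blast
  obtain k :: nat where "K < real k" using reals_Archimedean2 by blast
  also have "\<dots> \<le> enn2real (m k \<psi>)" by (rule \<psi>_big)
  also have "\<dots> \<le> enn2real (ennreal K)" by (intro enn2real_mono K(2)) simp
  finally show False using K(1) by simp
qed

section \<open>The exponents whose space equals \<open>BMO 1\<close>, and the trichotomy\<close>

lemma BMO_eq_imp_eq_BMO_1:
  assumes mm: "mm_space X \<rho> \<mu>" and p: "1 \<le> p1" "p1 < p2"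
    and eq: "BMO X \<rho> \<mu> p1 = BMO X \<rho> \<mu> p2"
  shows "BMO X \<rho> \<mu> p2 = BMO X \<rho> \<mu> 1"
proof
  show "BMO X \<rho> \<mu> p2 \<subseteq> BMO X \<rho> \<mu> 1" using p by (intro BMO_antimono[OF mm]) auto
  define q where "q = p2 / p1"
  have q: "1 < q" using p by (simp add: q_def)
  \<comment> \<open>While \<open>q ^ k \<le> p1\<close> the exponent can be multiplied by
    \<open>q\<close>. Once it passes \<open>p1\<close>, monotonicity and the assumed equality lead
    straight to \<open>BMO p2\<close>; the first disjunct records that this has happened.\<close>
  have *: "BMO X \<rho> \<mu> 1 \<subseteq> BMO X \<rho> \<mu> p2 \<or> BMO X \<rho> \<mu> 1 \<subseteq> BMO X \<rho> \<mu> (q ^ k)" for k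
  proof (induction k)
    case (Suc k)
    have q1: "1 \<le> q ^ k" using q by simp
    show ?case
    proof (cases "q ^ k \<le> p1")
      case True
      have "BMO X \<rho> \<mu> (q ^ k) \<subseteq> BMO X \<rho> \<mu> (q ^ k * p2 / p1)"
        using eq p by (intro BMO_self_improvement[OF mm q1 True]) auto
      also have "q ^ k * p2 / p1 = q ^ Suc k" by (simp add: q_def)
      finally show ?thesis using Suc.IH by blast
    next
      case False
      then have "BMO X \<rho> \<mu> (q ^ k) \<subseteq> BMO X \<rho> \<mu> p1" using p by (intro BMO_antimono[OF mm]) auto
      then show ?thesis using Suc.IH eq by blast
    qed
  qed auto
  obtain k where "p2 < q ^ k" using real_arch_pow[OF q] by blast
  then have "BMO X \<rho> \<mu> (q ^ k) \<subseteq> BMO X \<rho> \<mu> p2" using p by (intro BMO_antimono[OF mm]) auto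
  then show "BMO X \<rho> \<mu> 1 \<subseteq> BMO X \<rho> \<mu> p2" using *[of k] by blast
qed

text \<open>A coincidence propagates down to exponent 1, and conversely equality of the larger space
  with \<open>BMO 1\<close> squeezes everything in between. Questions about pairs of exponents thus
  become questions about one exponent.\<close>

lemma BMO_eq_iff:
  assumes mm: "mm_space X \<rho> \<mu>" and p: "1 \<le> p1" "1 \<le> p2" "p1 \<noteq> p2"
  shows "BMO X \<rho> \<mu> p1 = BMO X \<rho> \<mu> p2 \<longleftrightarrow> BMO X \<rho> \<mu> (max p1 p2) = BMO X \<rho> \<mu> 1"
proof -
  have *: "BMO X \<rho> \<mu> p = BMO X \<rho> \<mu> q \<longleftrightarrow> BMO X \<rho> \<mu> q = BMO X \<rho> \<mu> 1" if "1 \<le> p" "p < q" for p q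
    using BMO_eq_imp_eq_BMO_1[OF mm that] BMO_antimono[OF mm, of 1 p] BMO_antimono[OF mm, of p q] that by auto
  show ?thesis
  proof (cases "p1 < p2")
    case True
    then show ?thesis using *[OF p(1) True] by (simp add: max_def)
  next
    case False
    then show ?thesis using *[OF p(2), of p1] p by (auto simp: max_def)
  qed
qed

lemma caseA_iff:
  "caseA X \<rho> \<mu> \<longleftrightarrow> (\<forall>p\<ge>1. BMO X \<rho> \<mu> p = BMO X \<rho> \<mu> 1)"
  unfolding caseA_def by (metis order_refl)

lemma caseB_iff:
  assumes mm: "mm_space X \<rho> \<mu>"
  shows "caseB X \<rho> \<mu> p0 \<longleftrightarrow> 1 < p0 \<and> (\<forall>p>1. BMO X \<rho> \<mu> p = BMO X \<rho> \<mu> 1 \<longleftrightarrow> p < p0)"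
proof
  assume B: "caseB X \<rho> \<mu> p0"
  show "1 < p0 \<and> (\<forall>p>1. BMO X \<rho> \<mu> p = BMO X \<rho> \<mu> 1 \<longleftrightarrow> p < p0)"
  proof (intro conjI allI impI)
    show "1 < p0" using B by (simp add: caseB_def)
    fix p :: real assume "1 < p"
    then show "BMO X \<rho> \<mu> p = BMO X \<rho> \<mu> 1 \<longleftrightarrow> p < p0"
      using B[unfolded caseB_def, THEN conjunct2, rule_format, of p 1] by (simp add: max_def)
  qed
next
  assume *: "1 < p0 \<and> (\<forall>p>1. BMO X \<rho> \<mu> p = BMO X \<rho> \<mu> 1 \<longleftrightarrow> p < p0)"
  show "caseB X \<rho> \<mu> p0"
    unfolding caseB_def
  proof (intro conjI allI impI)
    fix p1 p2 :: real assume p: "1 \<le> p1" "1 \<le> p2" "p1 \<noteq> p2"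
    then have "1 < max p1 p2" by (auto simp: max_def)
    then show "BMO X \<rho> \<mu> p1 = BMO X \<rho> \<mu> p2 \<longleftrightarrow> max p1 p2 < p0"
      using * BMO_eq_iff[OF mm p] by blast
  qed (use * in blast)
qed

lemma caseC_iff:
  assumes mm: "mm_space X \<rho> \<mu>"
  shows "caseC X \<rho> \<mu> p0 \<longleftrightarrow> 1 \<le> p0 \<and> (\<forall>p>1. BMO X \<rho> \<mu> p = BMO X \<rho> \<mu> 1 \<longleftrightarrow> p \<le> p0)"
proof
  assume C: "caseC X \<rho> \<mu> p0"
  show "1 \<le> p0 \<and> (\<forall>p>1. BMO X \<rho> \<mu> p = BMO X \<rho> \<mu> 1 \<longleftrightarrow> p \<le> p0)"
  proof (intro conjI allI impI)
    show "1 \<le> p0" using C by (simp add: caseC_def)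
    fix p :: real assume "1 < p"
    then show "BMO X \<rho> \<mu> p = BMO X \<rho> \<mu> 1 \<longleftrightarrow> p \<le> p0"
      using C[unfolded caseC_def, THEN conjunct2, rule_format, of p 1] by (simp add: max_def)
  qed
next
  assume *: "1 \<le> p0 \<and> (\<forall>p>1. BMO X \<rho> \<mu> p = BMO X \<rho> \<mu> 1 \<longleftrightarrow> p \<le> p0)"
  show "caseC X \<rho> \<mu> p0"
    unfolding caseC_def
  proof (intro conjI allI impI)
    fix p1 p2 :: real assume p: "1 \<le> p1" "1 \<le> p2" "p1 \<noteq> p2"
    then have "1 < max p1 p2" by (auto simp: max_def)
    then show "BMO X \<rho> \<mu> p1 = BMO X \<rho> \<mu> p2 \<longleftrightarrow> max p1 p2 \<le> p0"
      using * BMO_eq_iff[OF mm p] by blast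
  qed (use * in blast)
qed

lemma BMO_trichotomy:
  assumes mm: "mm_space X \<rho> \<mu>"
  shows "(caseA X \<rho> \<mu> \<and> \<not> (\<exists>p0. caseB X \<rho> \<mu> p0) \<and> \<not> (\<exists>p0. caseC X \<rho> \<mu> p0)) \<or>
         (\<not> caseA X \<rho> \<mu> \<and> (\<exists>p0. caseB X \<rho> \<mu> p0) \<and> \<not> (\<exists>p0. caseC X \<rho> \<mu> p0)) \<or>
         (\<not> caseA X \<rho> \<mu> \<and> \<not> (\<exists>p0. caseB X \<rho> \<mu> p0) \<and> (\<exists>p0. caseC X \<rho> \<mu> p0))"
proof -
  define S where "S = {p. 1 \<le> p \<and> BMO X \<rho> \<mu> p = BMO X \<rho> \<mu> 1}"
  have S1: "1 \<in> S" by (simp add: S_def)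
  have S_down: "p \<in> S" if "q \<in> S" "1 \<le> p" "p \<le> q" for p q
    using that BMO_antimono[OF mm, of p q] BMO_antimono[OF mm, of 1 p] by (auto simp: S_def)
  have A: "caseA X \<rho> \<mu> \<longleftrightarrow> (\<forall>p\<ge>1. p \<in> S)" unfolding caseA_iff S_def by auto
  have B: "caseB X \<rho> \<mu> p0 \<longleftrightarrow> 1 < p0 \<and> (\<forall>p>1. p \<in> S \<longleftrightarrow> p < p0)" for p0
    unfolding caseB_iff[OF mm] S_def by (simp add: less_imp_le)
  have C: "caseC X \<rho> \<mu> p0 \<longleftrightarrow> 1 \<le> p0 \<and> (\<forall>p>1. p \<in> S \<longleftrightarrow> p \<le> p0)" for p0
    unfolding caseC_iff[OF mm] S_def by (simp add: less_imp_le)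
  have AB: "\<not> caseB X \<rho> \<mu> p0" if "caseA X \<rho> \<mu>" for p0
    using that A B[of p0] by auto
  have AC: "\<not> caseC X \<rho> \<mu> p0" if "caseA X \<rho> \<mu>" for p0
  proof
    assume "caseC X \<rho> \<mu> p0"
    then have "1 \<le> p0" "p0 + 1 \<in> S \<longleftrightarrow> p0 + 1 \<le> p0" using C[of p0] by auto
    then show False using that A by simp
  qed
  have BC: "\<not> caseC X \<rho> \<mu> p1" if "caseB X \<rho> \<mu> p0" for p0 p1
  proof
    assume "caseC X \<rho> \<mu> p1"
    then have p1: "1 \<le> p1" and eq: "\<And>p. 1 < p \<Longrightarrow> p < p0 \<longleftrightarrow> p \<le> p1"
      using \<open>caseB X \<rho> \<mu> p0\<close> B C by blast+
    have "1 < p0" using \<open>caseB X \<rho> \<mu> p0\<close> B by blast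
    with eq[of p0] have "p1 < p0" by simp
    \<comment> \<open>The midpoint is below the open endpoint \<open>p0\<close> but above the closed
      endpoint \<open>p1\<close>, so the two descriptions disagree there.\<close>
    with eq[of "(p1 + p0) / 2"] p1 show False by simp
  qed
  have "caseA X \<rho> \<mu> \<or> (\<exists>p0. caseB X \<rho> \<mu> p0) \<or> (\<exists>p0. caseC X \<rho> \<mu> p0)"
  proof (cases "bdd_above S")
    case True
    \<comment> \<open>An attained supremum gives the closed interval, possibly only {1}. An
      unattained one exceeds 1 because 1 belongs to \<open>S\<close>.\<close>
    define p0 where "p0 = Sup S"
    have ub: "p \<le> p0" if "p \<in> S" for p using that True by (simp add: p0_def cSup_upper)
    have inner: "p \<in> S" if "1 < p" "p < p0" for p
      using less_cSup_iff[of S p] S1 True that S_down[of _ p] unfolding p0_def by force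
    show ?thesis
    proof (cases "p0 \<in> S")
      case True
      have "p \<in> S \<longleftrightarrow> p \<le> p0" if "1 < p" for p
        using ub[of p] S_down[OF True, of p] that by auto
      then have "caseC X \<rho> \<mu> p0" using ub[OF S1] by (simp add: C)
      then show ?thesis by blast
    next
      case False
      have "p \<in> S \<longleftrightarrow> p < p0" if "1 < p" for p
        using ub[of p] inner[of p] that False by (auto simp: less_le)
      moreover have "1 < p0" using ub[OF S1] False S1 by (auto simp: less_le)
      ultimately have "caseB X \<rho> \<mu> p0" by (simp add: B)
      then show ?thesis by blast
    qed
  next
    case False
    then have "\<exists>q\<in>S. p \<le> q" for p unfolding bdd_above_def by (meson linear)
    then have "caseA X \<rho> \<mu>" unfolding A using S_down by meson
    then show ?thesis by blast
  qed
  then show ?thesis using AB AC BC by blast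
qed

section \<open>Weighted paths and their BMO spaces\<close>

text \<open>The examples live on the natural numbers (as a subset of the reals) with a metric for which
  every ball is either contained in a closed neighbourhood of its centre in the path graph or is the
  whole space. If consecutive weights are comparable, the small balls force a BMO function to be
  Lipschitz along the path, and every Lipschitz function is in BMO on small balls, for each exponent.\<close>

definition path_dist :: "real \<Rightarrow> real \<Rightarrow> real" where
  "path_dist x y = (if x = y then 0 else if \<bar>x - y\<bar> = 1 then 1 else 2)"

text \<open>Atoms of mass \<open>w n\<close>, pushed forward onto the full power set. This is the
  Borel sigma-algebra because balls of radius 1 are singletons and the topology is discrete.\<close>

definition path_measure :: "(nat \<Rightarrow> real) \<Rightarrow> real measure" where
  "path_measure w = distr (density (count_space UNIV) (\<lambda>n. ennreal (w n))) (count_space (range real)) real"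

text \<open>Nonzero distances are 1 or 2, so the sum of two of them is at least 2 and the triangle
  inequality cannot fail.\<close>

lemma Metric_space_path: "Metric_space (range real) path_dist"
  by standard (auto simp: path_dist_def abs_minus_commute)

lemma openin_path: "openin (Metric_space.mtopology (range real) path_dist) U \<longleftrightarrow> U \<subseteq> range real"
proof -
  interpret Metric_space "range real" path_dist by (rule Metric_space_path)
  have "mball x 1 \<subseteq> U" if "x \<in> U" for x U
    using that by (auto simp: path_dist_def split: if_splits)
  then show ?thesis unfolding openin_mtopology using zero_less_one by blast
qed

lemma sets_path_measure: "sets (path_measure w) = Pow (range real)"
  and space_path_measure: "space (path_measure w) = range real"
  by (simp_all add: path_measure_def)

lemma mm_space_path: "mm_space (range real) path_dist (path_measure w)"
proof -
  have "{U. openin (Metric_space.mtopology (range real) path_dist) U} = Pow (range real)"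
    by (auto simp: openin_path)
  then show ?thesis
    by (simp add: mm_space_def Metric_space_path sets_path_measure space_path_measure
        sigma_algebra.sigma_sets_eq[OF sigma_algebra_Pow])
qed

lemma nn_integral_path_measure:
  "(\<integral>\<^sup>+x. g x \<partial>path_measure w) = (\<Sum>n. ennreal (w n) * g (real n))"
  unfolding path_measure_def
  by (subst nn_integral_distr) (simp_all add: nn_integral_density nn_integral_count_space_nat)

text \<open>The threshold is radius 2: an open ball of radius at most 2 misses all points at
  distance 2 and keeps only the centre and possibly its neighbours.\<close>

lemma path_ball_cases:
  assumes "B \<in> open_balls (range real) path_dist"
  obtains "B = range real" | n where "real n \<in> B" "\<And>x. x \<in> B \<Longrightarrow> \<exists>m. x = real m \<and> (m = n \<or> m = Suc n \<or> Suc m = n)"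
proof -
  interpret Metric_space "range real" path_dist by (rule Metric_space_path)
  obtain n r where B: "B = mball (real n) r" "r > 0" using assms by (auto simp: open_balls_def)
  show ?thesis
  proof (cases "r \<le> 2")
    case True
    have "\<exists>m. x = real m \<and> (m = n \<or> m = Suc n \<or> Suc m = n)" if "x \<in> B" for x
    proof -
      obtain m where m: "x = real m" "path_dist (real n) (real m) < r" using \<open>x \<in> B\<close> by (auto simp: B)
      then have "n = m \<or> \<bar>real n - real m\<bar> = 1" using True by (auto simp: path_dist_def split: if_splits)
      then have "m = n \<or> m = Suc n \<or> Suc m = n" by linarith
      then show ?thesis using m by blast
    qed
    moreover have "real n \<in> B" using B by (simp add: path_dist_def)
    ultimately show ?thesis using that(2) by blast
  next
    case False
    then have "B = range real" by (auto simp: B path_dist_def)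
    then show ?thesis by (rule that(1))
  qed
qed

lemma range_real_open_ball: "range real \<in> open_balls (range real) path_dist"
proof -
  interpret Metric_space "range real" path_dist by (rule Metric_space_path)
  have "range real = mball (real 0) 3" by (auto simp: path_dist_def)
  moreover have "real 0 \<in> range real" "(3 :: real) > 0" by (rule rangeI) simp
  ultimately show ?thesis unfolding open_balls_def by blast
qed

lemma path_triple_open_ball: "real ` {n - 1..Suc n} \<in> open_balls (range real) path_dist"
proof -
  interpret Metric_space "range real" path_dist by (rule Metric_space_path)
  \<comment> \<open>At \<open>n = 0\<close> truncated subtraction yields {0, 1}, which is the
    correct ball at the end of the path.\<close>
  have "mball (real n) (3/2) = real ` {n - 1..Suc n}"
  proof (intro equalityI subsetI)
    fix x assume "x \<in> mball (real n) (3/2)"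
    then obtain m where m: "x = real m" "path_dist (real n) (real m) < 3/2" by auto
    then have "n = m \<or> \<bar>real n - real m\<bar> = 1" by (auto simp: path_dist_def split: if_splits)
    then have "m \<in> {n - 1..Suc n}" by auto
    then show "x \<in> real ` {n - 1..Suc n}" using m by blast
  next
    fix x assume "x \<in> real ` {n - 1..Suc n}"
    then obtain m where m: "x = real m" "n - 1 \<le> m" "m \<le> Suc n" by auto
    then have "m = n \<or> m = Suc n \<or> Suc m = n" by auto
    then show "x \<in> mball (real n) (3/2)" using m by (auto simp: path_dist_def)
  qed
  moreover have "real n \<in> range real" "(3/2 :: real) > 0" by (rule rangeI) simp
  ultimately show ?thesis unfolding open_balls_def by blast
qed

text \<open>Monotonicity and the one-sided doubling bound together make neighbouring weights
  comparable, which forces \<open>BMO 1\<close> functions to be Lipschitz. The finite first moment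
  puts every Lipschitz function into \<open>BMO 1\<close>.\<close>

locale path_weight =
  fixes w :: "nat \<Rightarrow> real" and K :: real
  assumes w_pos: "\<And>n. 0 < w n" and w_anti: "\<And>n. w (Suc n) \<le> w n"
    and w_doubling: "\<And>n. w n \<le> K * w (Suc n)"
    and summable_first_moment: "summable (\<lambda>n. w n * real n)"
begin

abbreviation "X \<equiv> range real"
abbreviation "\<mu> \<equiv> path_measure w"

lemmas mm = mm_space_path[of w]

lemma K_ge_1: "1 \<le> K"
proof -
  have "1 * w (Suc 0) \<le> K * w (Suc 0)" using w_anti[of 0] w_doubling[of 0] by simp
  then show ?thesis using w_pos[of "Suc 0"] by simp
qed

lemma summable_w: "summable w"
proof (rule summable_comparison_test_ev[OF _ summable_first_moment])
  show "\<forall>\<^sub>F n in sequentially. norm (w n) \<le> w n * real n"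
    using eventually_ge_at_top[of 1] by eventually_elim (simp add: w_pos less_imp_le)
qed

lemma emeasure_path_less_top: "emeasure \<mu> B < \<infinity>"
proof -
  have "emeasure \<mu> (space \<mu>) = (\<Sum>n. ennreal (w n))"
    using nn_integral_path_measure[where g = "\<lambda>_. 1" and w = w] by simp
  also have "\<dots> < \<infinity>" 
    using summable_w w_pos by (simp add: less_imp_le less_top[symmetric] ennreal_suminf_neq_top)
  finally show ?thesis using emeasure_space[of \<mu> B] by (rule le_less_trans[rotated])
qed

lemma point_le_nn_integral: "ennreal (w n) * g (real n) \<le> (\<integral>\<^sup>+x. g x \<partial>\<mu>)"
proof -
  have "sum (\<lambda>n. ennreal (w n) * g (real n)) {n} \<le> (\<Sum>n. ennreal (w n) * g (real n))"
    by (intro sum_le_suminf) auto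
  then show ?thesis by (simp add: nn_integral_path_measure)
qed

lemma good_ballI:
  assumes "B \<in> open_balls X path_dist" "real n \<in> B"
  shows "B \<in> good_balls X path_dist \<mu>"
proof -
  have "B \<in> sets \<mu>" using open_balls_sets[OF mm assms(1)] .
  then have "ennreal (w n) \<le> emeasure \<mu> B"
    using point_le_nn_integral[of n "indicator B"] assms(2) by simp
  moreover have "0 < ennreal (w n)" using w_pos[of n] by simp
  ultimately have "0 < emeasure \<mu> B" by (rule less_le_trans[rotated])
  then show ?thesis using assms(1) emeasure_path_less_top by (simp add: good_balls_def)
qed

lemma X_good_ball: "X \<in> good_balls X path_dist \<mu>"
  using good_ballI[OF range_real_open_ball, of 0] by simp

lemma mean_nn_X_finite_iff:
  assumes "\<And>x. 0 \<le> F x"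
  shows "mean_nn (restrict_space \<mu> X) F < \<infinity> \<longleftrightarrow> summable (\<lambda>n. w n * F (real n))"
proof -
  have "restrict_space \<mu> X = \<mu>" 
    by (rule measure_eqI)
      (auto simp: sets_restrict_space emeasure_restrict_space sets_path_measure space_path_measure)
  moreover have "emeasure \<mu> X \<noteq> 0" "emeasure \<mu> X < \<infinity>"
    using X_good_ball by (auto simp: good_balls_def)
  ultimately have "mean_nn (restrict_space \<mu> X) F < \<infinity> \<longleftrightarrow> (\<Sum>n. ennreal (w n * F (real n))) < \<infinity>"
    using w_pos assms
    by (simp add: mean_nn_def nn_integral_path_measure space_path_measure ennreal_mult less_imp_le
        divide_less_ennreal ennreal_divide_eq_top_iff less_top)
  also have "\<dots> \<longleftrightarrow> summable (\<lambda>n. w n * F (real n))"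
    using w_pos assms by (auto simp: less_imp_le less_top[symmetric] ennreal_suminf_neq_top intro: summable_suminf_not_top)
  finally show ?thesis .
qed

lemma lipschitz_diff_le:
  fixes f :: "real \<Rightarrow> real"
  assumes "\<And>n. \<bar>f (real (Suc n)) - f (real n)\<bar> \<le> D"
  shows "\<bar>f (real n) - f 0\<bar> \<le> D * real n"
proof (induction n)
  case (Suc n)
  then show ?case using assms[of n] by (simp add: distrib_left)
qed simp

text \<open>About the centre \<open>f 0\<close>, the oscillation over the whole space is controlled
  by \<open>D powr p\<close> times the \<open>p\<close>-th moment of the weights. On a small ball
  all values lie within \<open>D\<close> of the one at the centre of the ball.\<close>

lemma lipschitz_imp_BMO:
  assumes lip: "\<And>n. \<bar>f (real (Suc n)) - f (real n)\<bar> \<le> D" and p: "1 \<le> p"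
    and sm: "summable (\<lambda>n. w n * real n powr p)"
  shows "f \<in> BMO X path_dist \<mu> p"
proof -
  have D: "0 \<le> D" using lip[of 0] by linarith
  have int: "integrable \<mu> f"
  proof (rule integrableI_bounded)
    show "f \<in> borel_measurable \<mu>" by (simp add: path_measure_def)
    have sm1: "summable (\<lambda>n. \<bar>f 0\<bar> * w n + D * (w n * real n))"
      using summable_w summable_first_moment by (intro summable_add summable_mult)
    have "summable (\<lambda>n. w n * \<bar>f (real n)\<bar>)"
    proof (rule summable_comparison_test'[OF sm1])
      fix n :: nat
      have "w n * \<bar>f (real n)\<bar> \<le> w n * (\<bar>f 0\<bar> + D * real n)"
        using lipschitz_diff_le[OF lip, of n] w_pos[of n] by (intro mult_left_mono) linarith+
      then show "norm (w n * \<bar>f (real n)\<bar>) \<le> \<bar>f 0\<bar> * w n + D * (w n * real n)"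
        using w_pos[of n] by (simp add: abs_mult algebra_simps)
    qed
    then have "(\<Sum>n. ennreal (w n * \<bar>f (real n)\<bar>)) < \<infinity>"
      using w_pos by (simp add: less_imp_le less_top[symmetric] ennreal_suminf_neq_top)
    then show "(\<integral>\<^sup>+x. ennreal (norm (f x)) \<partial>\<mu>) < \<infinity>"
      using w_pos by (simp add: nn_integral_path_measure ennreal_mult less_imp_le)
  qed
  have loc: "loc_integrable X path_dist \<mu> f"
    unfolding loc_integrable_def set_integrable_def
    using integrable_mult_indicator[OF _ int] open_balls_sets[OF mm] by blast
  have "mean_nn (restrict_space \<mu> X) (\<lambda>x. \<bar>f x - f 0\<bar> powr p) < \<infinity>"
    unfolding mean_nn_X_finite_iff[OF powr_ge_zero]
  proof (rule summable_comparison_test'[OF summable_mult[OF sm, of "D powr p"]])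
    fix n :: nat
    have "\<bar>f (real n) - f 0\<bar> powr p \<le> (D * real n) powr p"
      using p lipschitz_diff_le[OF lip, of n] by (intro powr_mono2) auto
    then have "w n * \<bar>f (real n) - f 0\<bar> powr p \<le> w n * (D powr p * real n powr p)"
      using w_pos[of n] by (intro mult_left_mono) (simp_all add: powr_mult less_imp_le)
    then show "norm (w n * \<bar>f (real n) - f 0\<bar> powr p) \<le> D powr p * (w n * real n powr p)"
      using w_pos[of n] by (simp add: abs_mult algebra_simps)
  qed
  then obtain A where A: "0 \<le> A" "mean_nn (restrict_space \<mu> X) (\<lambda>x. \<bar>f x - f 0\<bar> powr p) = ennreal A"
    by (cases "mean_nn (restrict_space \<mu> X) (\<lambda>x. \<bar>f x - f 0\<bar> powr p)") auto
  have "\<exists>c. mean_nn (restrict_space \<mu> B) (\<lambda>x. \<bar>f x - c\<bar> powr p) \<le> ennreal (A + D powr p)"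
    if B: "B \<in> good_balls X path_dist \<mu>" for B
  proof -
    interpret R: pos_finite_measure "restrict_space \<mu> B" using good_ball_restrict[OF mm B] by simp
    have "B \<in> open_balls X path_dist" using B by (simp add: good_balls_def)
    then show ?thesis
    proof (cases rule: path_ball_cases)
      case 1
      then have "mean_nn (restrict_space \<mu> B) (\<lambda>x. \<bar>f x - f 0\<bar> powr p) \<le> ennreal (A + D powr p)"
        using A by (simp del: ennreal_plus add: ennreal_leI)
      then show ?thesis by blast
    next
      case (2 n)
      have "mean_nn (restrict_space \<mu> B) (\<lambda>x. \<bar>f x - f (real n)\<bar> powr p) \<le> ennreal (D powr p + 0 * 0)"
      proof (rule R.mean_nn_affine_le[where G = "\<lambda>_. 0"])
        fix x assume "x \<in> space (restrict_space \<mu> B)"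
        then obtain m where m: "x = real m" "m = n \<or> m = Suc n \<or> Suc m = n"
          using 2(2)[of x] good_ball_restrict(2)[OF mm B] by auto
        then have "\<bar>f x - f (real n)\<bar> \<le> D"
          using D lip[of n] lip[of m] by (auto simp: abs_minus_commute)
        then show "\<bar>f x - f (real n)\<bar> powr p \<le> D powr p + 0 * 0"
          using p by (simp add: powr_mono2)
      qed (auto simp: R.mean_nn_const)
      also have "\<dots> \<le> ennreal (A + D powr p)" using A(1) by (intro ennreal_leI) simp
      finally show ?thesis by blast
    qed
  qed
  then obtain c where "\<And>B. B \<in> good_balls X path_dist \<mu> \<Longrightarrow>
      mean_nn (restrict_space \<mu> B) (\<lambda>x. \<bar>f x - c B\<bar> powr p) \<le> ennreal (A + D powr p)"
    by metis
  then show ?thesis using A(1) by (intro BMO_I[OF mm loc p, of "A + D powr p" c]) auto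
qed

text \<open>The ball around \<open>n\<close> has at most three atoms of comparable mass. Each
  carries a fixed share of the total, so a bounded mean oscillation bounds the deviation at every
  atom, in particular at \<open>n\<close> and \<open>Suc n\<close>.\<close>

lemma BMO_imp_lipschitz:
  assumes f: "f \<in> BMO X path_dist \<mu> 1"
  obtains D where "\<And>n. \<bar>f (real (Suc n)) - f (real n)\<bar> \<le> D"
proof -
  obtain A where A: "0 \<le> A" "\<And>B. B \<in> good_balls X path_dist \<mu> \<Longrightarrow>
    mean_nn (restrict_space \<mu> B) (\<lambda>x. \<bar>f x - ball_avg \<mu> f B\<bar> powr 1) \<le> ennreal A"
    using BMO_D[OF mm f] by blast
  show ?thesis
  proof (rule that)
    fix n
    define B where "B = real ` {n - 1..Suc n}"
    define m where "m = ball_avg \<mu> f B"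
    have nB: "real n \<in> B" "real (Suc n) \<in> B" unfolding B_def by (intro imageI; simp)+
    have B: "B \<in> good_balls X path_dist \<mu>"
      using good_ballI[OF path_triple_open_ball] nB(1) unfolding B_def by blast
    note Bs = good_ball_restrict(3)[OF mm B]
    have "emeasure \<mu> B = (\<Sum>k. ennreal (w k) * indicator B (real k))"
      using nn_integral_path_measure[where g = "indicator B" and w = w] Bs by simp
    also have "\<dots> = (\<Sum>k\<in>{n - 1..Suc n}. ennreal (w k) * indicator B (real k))"
      by (intro suminf_finite) (auto simp: B_def indicator_def)
    also have "\<dots> \<le> (\<Sum>k\<in>{n - 1..Suc n}. ennreal (K * w n))"
    proof (intro sum_mono)
      fix k assume "k \<in> {n - 1..Suc n}"
      then have "k = n \<or> k = Suc n \<or> Suc k = n" by auto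
      \<comment> \<open>The right neighbour is lighter by monotonicity; the left one is at most
        \<open>K\<close> times heavier by doubling.\<close>
      then have "w k \<le> w n \<or> w k \<le> K * w n"
        using w_anti[of n] w_doubling[of k] by auto
      moreover have "1 * w n \<le> K * w n" using K_ge_1 w_pos[of n] by (intro mult_right_mono) auto
      ultimately have "w k \<le> K * w n" by linarith
      then show "ennreal (w k) * indicator B (real k) \<le> ennreal (K * w n)"
        by (auto simp: indicator_def ennreal_leI)
    qed
    also have "\<dots> = ennreal (\<Sum>k\<in>{n - 1..Suc n}. K * w n)"
      using K_ge_1 w_pos[of n] by (intro sum_ennreal) auto
    also have "\<dots> \<le> ennreal (3 * (K * w n))"
    proof -
      have "card {n - 1..Suc n} \<le> 3" by simp
      then show ?thesis
        unfolding sum_constant using K_ge_1 w_pos[of n] by (intro ennreal_leI mult_right_mono) simp_all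
    qed
    finally have mB: "emeasure \<mu> B \<le> ennreal (3 * (K * w n))" .
    have em: "emeasure \<mu> B \<noteq> 0" "emeasure \<mu> B \<noteq> top" using B by (auto simp: good_balls_def)
    have "bmo_osc \<mu> 1 f B \<le> ennreal A" using A(2)[OF B] by (simp add: bmo_osc_restrict[OF Bs])
    then have "(\<integral>\<^sup>+x. ennreal (\<bar>f x - m\<bar>) * indicator B x \<partial>\<mu>) / emeasure \<mu> B * emeasure \<mu> B
        \<le> ennreal A * emeasure \<mu> B"
      by (intro mult_right_mono) (simp_all add: bmo_osc_def m_def)
    then have "(\<integral>\<^sup>+x. ennreal (\<bar>f x - m\<bar>) * indicator B x \<partial>\<mu>) \<le> ennreal A * emeasure \<mu> B"
      using em by (simp add: ennreal_divide_times less_top)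
    also have "\<dots> \<le> ennreal A * ennreal (3 * (K * w n))" by (intro mult_left_mono mB) simp
    also have "\<dots> = ennreal (3 * A * K * w n)"
      using A(1) K_ge_1 w_pos[of n] by (simp flip: ennreal_mult add: ac_simps)
    finally have I: "(\<integral>\<^sup>+x. ennreal (\<bar>f x - m\<bar>) * indicator B x \<partial>\<mu>) \<le> ennreal (3 * A * K * w n)" .
    have pt: "w k * \<bar>f (real k) - m\<bar> \<le> 3 * A * K * w n" if "real k \<in> B" for k
    proof -
      have "ennreal (w k * \<bar>f (real k) - m\<bar>) \<le> ennreal (3 * A * K * w n)"
        using order_trans[OF point_le_nn_integral[of k] I] that w_pos[of k]
        by (simp add: ennreal_mult less_imp_le)
      then show ?thesis using A(1) K_ge_1 w_pos[of n] by (subst (asm) ennreal_le_iff) auto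
    qed
    have "\<bar>f (real n) - m\<bar> \<le> 3 * A * K"
      using pt[OF nB(1)] w_pos[of n] by (simp add: mult.commute)
    moreover have "\<bar>f (real (Suc n)) - m\<bar> \<le> 3 * A * K * K"
    proof -
      have "w (Suc n) * \<bar>f (real (Suc n)) - m\<bar> \<le> 3 * A * K * w n" by (rule pt[OF nB(2)])
      also have "\<dots> \<le> 3 * A * K * (K * w (Suc n))"
        using A(1) K_ge_1 by (intro mult_left_mono w_doubling) auto
      finally show ?thesis using w_pos[of "Suc n"] by (simp add: mult.commute)
    qed
    ultimately show "\<bar>f (real (Suc n)) - f (real n)\<bar> \<le> 3 * A * K + 3 * A * K * K" by linarith
  qed
qed

text \<open>The identity is the extremal test function: it is Lipschitz, and its
  \<open>p\<close>-oscillation over the whole space, recentred at 0, is the normalized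
  \<open>p\<close>-th moment of the weights.\<close>

lemma BMO_eq_BMO_1_iff:
  assumes p: "1 \<le> p"
  shows "BMO X path_dist \<mu> p = BMO X path_dist \<mu> 1 \<longleftrightarrow> summable (\<lambda>n. w n * real n powr p)"
proof
  assume eq: "BMO X path_dist \<mu> p = BMO X path_dist \<mu> 1"
  have "(\<lambda>x. x) \<in> BMO X path_dist \<mu> 1"
    using summable_first_moment by (intro lipschitz_imp_BMO[where D = 1]) auto
  then have f: "(\<lambda>x. x) \<in> BMO X path_dist \<mu> p" by (simp add: eq)
  obtain A where A: "0 \<le> A" "\<And>B. B \<in> good_balls X path_dist \<mu> \<Longrightarrow>
    mean_nn (restrict_space \<mu> B) (\<lambda>x. \<bar>x - ball_avg \<mu> (\<lambda>x. x) B\<bar> powr p) \<le> ennreal A"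
    using BMO_D[OF mm f] by blast
  interpret R: pos_finite_measure "restrict_space \<mu> X" using good_ball_restrict[OF mm X_good_ball] by simp
  have "integrable (restrict_space \<mu> X) (\<lambda>x. x)"
    using loc_integrable_restrict[OF mm _ X_good_ball] f by (simp add: BMO_iff)
  then have "mean_nn (restrict_space \<mu> X) (\<lambda>x. \<bar>x - 0\<bar> powr p) < \<infinity>"
    using R.mean_nn_recenter[OF _ _ A(1) A(2)[OF X_good_ball], of 0 "\<bar>ball_avg \<mu> (\<lambda>x. x) X - 0\<bar>"] p
    by (auto simp del: ennreal_plus elim!: le_less_trans)
  then show "summable (\<lambda>n. w n * real n powr p)"
    by (subst (asm) mean_nn_X_finite_iff) auto
next
  assume sm: "summable (\<lambda>n. w n * real n powr p)"
  have "f \<in> BMO X path_dist \<mu> p" if "f \<in> BMO X path_dist \<mu> 1" for f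
    using BMO_imp_lipschitz[OF that] lipschitz_imp_BMO[OF _ p sm] by metis
  then show "BMO X path_dist \<mu> p = BMO X path_dist \<mu> 1"
    using BMO_antimono[OF mm order_refl p] by blast
qed

end

section \<open>The three families of weights\<close>

lemma path_weight_exp: "path_weight (\<lambda>n. exp (- real n)) (exp 1)"
  and summable_exp_powr: "0 < p \<Longrightarrow> summable (\<lambda>n. exp (- real n) * real n powr p)"
proof -
  have *: "summable (\<lambda>n. exp (- real n) * real n powr p)" if "0 < p" for p
  proof (rule summable_comparison_test_ev)
    have "\<forall>\<^sub>F n in sequentially. exp (- real n) * real n powr p \<le> real n powr (-2)"
      using that by real_asymp
    then show "\<forall>\<^sub>F n in sequentially. norm (exp (- real n) * real n powr p) \<le> real n powr (-2)"
      by simp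
    show "summable (\<lambda>n. real n powr (-2))" by (subst summable_real_powr_iff) simp
  qed
  show "0 < p \<Longrightarrow> summable (\<lambda>n. exp (- real n) * real n powr p)" by (rule *)
  show "path_weight (\<lambda>n. exp (- real n)) (exp 1)"
    using *[of 1] by unfold_locales (auto simp flip: exp_add)
qed

text \<open>The \<open>p\<close>-th moment is the sum of \<open>n powr (p - a - 1)\<close>, finite
  exactly for \<open>p < a\<close>. Since \<open>0 powr x = 0\<close>, the value at 0 is set by
  hand, equal to the one at 1, to keep the weight positive and decreasing.\<close>

definition powr_weight :: "real \<Rightarrow> nat \<Rightarrow> real" where
  "powr_weight a n = (if n = 0 then 1 else real n powr (- 1 - a))"

lemma powr_weight_mult_powr: "powr_weight a n * real n powr p = real n powr (p - a - 1)"
  by (auto simp: powr_weight_def simp flip: powr_add intro: arg_cong2[where f = "(powr)"])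

lemma powr_weight_bounds:
  assumes "0 < a"
  shows "0 < powr_weight a n" "powr_weight a (Suc n) \<le> powr_weight a n"
    "powr_weight a n \<le> 2 powr (1 + a) * powr_weight a (Suc n)"
proof -
  show "0 < powr_weight a n" by (simp add: powr_weight_def)
  show "powr_weight a (Suc n) \<le> powr_weight a n"
    using assms by (auto simp: powr_weight_def intro!: powr_mono2')
  show "powr_weight a n \<le> 2 powr (1 + a) * powr_weight a (Suc n)"
  proof (cases "n = 0")
    case True
    then show ?thesis using assms by (simp add: powr_weight_def ge_one_powr_ge_zero)
  next
    case False
    \<comment> \<open>Here \<open>(n + 1) / 2 \<le> n\<close> for \<open>n \<ge> 1\<close>, which is
      where the constant \<open>2 powr (1 + a)\<close> comes from.\<close>
    have "(real (Suc n) / 2) powr (- 1 - a) \<ge> real n powr (- 1 - a)"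
      using False assms by (intro powr_mono2') auto
    then have "real n powr (- 1 - a) \<le> real (Suc n) powr (- 1 - a) / 2 powr (- 1 - a)"
      by (simp add: powr_divide)
    also have "2 powr (- 1 - a) = inverse (2 powr (1 + a))"
      by (simp flip: powr_minus)
    finally show ?thesis using False by (simp add: powr_weight_def field_simps)
  qed
qed

lemma path_weight_powr:
  assumes "1 < a"
  shows "path_weight (powr_weight a) (2 powr (1 + a))"
proof
  show "summable (\<lambda>n. powr_weight a n * real n)"
    using powr_weight_mult_powr[of a _ 1] assms by (simp add: summable_real_powr_iff)
qed (use assms in \<open>auto intro!: powr_weight_bounds\<close>)

text \<open>The squared logarithm makes the boundary moment \<open>p = a\<close> converge without
  affecting any larger \<open>p\<close>. The summand 1 and the maximum keep the denominator at least
  1, also at \<open>n = 0\<close> and \<open>n = 1\<close>.\<close>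

definition log_weight :: "real \<Rightarrow> nat \<Rightarrow> real" where
  "log_weight a n = powr_weight a n / (1 + ln (real (max 1 n)))\<^sup>2"

lemma log_weight_mult_powr:
  "log_weight a n * real n powr p = real n powr (p - a - 1) / (1 + ln (real (max 1 n)))\<^sup>2"
  using powr_weight_mult_powr[of a n p] by (simp add: log_weight_def)

text \<open>For \<open>p > a\<close> any positive power beats the logarithm, so the harmonic series
  is a lower bound. For \<open>p \<le> a\<close> the terms are dominated by the borderline series
  \<open>g\<close>, which Cauchy condensation turns into one of the size of the sum of
  \<open>1 / n\<^sup>2\<close>.\<close>

lemma summable_log_weight_iff:
  "summable (\<lambda>n. log_weight a n * real n powr p) \<longleftrightarrow> p \<le> a"
proof
  assume sm: "summable (\<lambda>n. log_weight a n * real n powr p)"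
  show "p \<le> a"
  proof (rule ccontr)
    assume "\<not> p \<le> a"
    then have e: "p - a > 0" by simp
    have "\<forall>\<^sub>F n in sequentially. real n powr (-1) \<le> real n powr (p - a - 1) / (1 + ln (real n))\<^sup>2"
      using e by real_asymp
    then have "\<forall>\<^sub>F n in sequentially. norm (real n powr (-1)) \<le> log_weight a n * real n powr p"
      using eventually_ge_at_top[of 1]
      by eventually_elim (simp add: log_weight_mult_powr max_def)
    from summable_comparison_test_ev[OF this sm] show False
      by (subst (asm) summable_real_powr_iff) simp
  qed
next
  assume "p \<le> a"
  define g where "g n = real n powr (-1) / (1 + ln (real (max 1 n)))\<^sup>2" for n
  have "summable g \<longleftrightarrow> summable (\<lambda>n. 2 ^ n * g (2 ^ n))"
  proof (rule condensation_test)
    fix m :: nat assume "0 < m"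
    then have "real (Suc m) powr (-1) \<le> real m powr (-1)" by (intro powr_mono2') auto
    moreover have "0 \<le> ln (real (max 1 m))" by (rule ln_ge_zero) simp
    moreover have "ln (real (max 1 m)) \<le> ln (real (max 1 (Suc m)))" by simp
    ultimately show "g (Suc m) \<le> g m" unfolding g_def
      by - (intro frac_le power_mono zero_less_power; (linarith | simp))
  qed (simp add: g_def)
  moreover have "summable (\<lambda>n. 2 ^ n * g (2 ^ n))"
  proof (rule summable_comparison_test_ev)
    have "2 ^ n * g (2 ^ n) = 1 / (1 + real n * ln 2)\<^sup>2" for n
      by (simp add: g_def powr_minus ln_realpow max_def)
    moreover have "\<forall>\<^sub>F n in sequentially. 1 / (1 + real n * ln 2)\<^sup>2 \<le> 1 / (ln 2)\<^sup>2 * real n powr (-2)"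
      using eventually_ge_at_top[of 1]
    proof eventually_elim
      fix n :: nat assume "1 \<le> n"
      then have "1 / (1 + real n * ln 2)\<^sup>2 \<le> 1 / (real n * ln 2)\<^sup>2"
        by (intro frac_le power_mono) auto
      also have "\<dots> = 1 / (ln 2)\<^sup>2 * real n powr (-2)"
        by (simp add: powr_minus power_mult_distrib field_simps)
      finally show "1 / (1 + real n * ln 2)\<^sup>2 \<le> 1 / (ln 2)\<^sup>2 * real n powr (-2)" .
    qed
    ultimately show "\<forall>\<^sub>F n in sequentially. norm (2 ^ n * g (2 ^ n)) \<le> 1 / (ln 2)\<^sup>2 * real n powr (-2)"
      by simp
    show "summable (\<lambda>n. 1 / (ln 2)\<^sup>2 * real n powr (-2))"
      by (intro summable_mult) (simp add: summable_real_powr_iff)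
  qed
  ultimately have "summable g" by simp
  then show "summable (\<lambda>n. log_weight a n * real n powr p)"
  proof (rule summable_comparison_test')
    fix n :: nat
    have "real n powr (p - a - 1) \<le> real n powr (-1)"
    proof (cases "n = 0")
      case False
      then show ?thesis using \<open>p \<le> a\<close> by (intro powr_mono) auto
    qed simp
    then have "real n powr (p - a - 1) / (1 + ln (real (max 1 n)))\<^sup>2 \<le> g n"
      unfolding g_def by (rule divide_right_mono) simp
    then show "norm (log_weight a n * real n powr p) \<le> g n"
      unfolding log_weight_mult_powr by simp
  qed
qed

text \<open>The first moment is finite even at \<open>a = 1\<close>, so the closed case includes the
  endpoint 1, which pure powers cannot reach.\<close>

lemma path_weight_log:
  assumes "1 \<le> a"
  shows "path_weight (log_weight a) (2 powr (1 + a) * 4)"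
proof
  fix n
  have ln_nonneg: "0 \<le> ln (real (max 1 m))" for m
    by (rule ln_ge_zero) simp
  have pos: "0 < 1 + ln (real (max 1 m))" for m
    using ln_nonneg[of m] by linarith
  show "0 < log_weight a n" using powr_weight_bounds(1)[of a n] assms pos[of n] by (simp add: log_weight_def)
  have ln_mono: "1 + ln (real (max 1 n)) \<le> 1 + ln (real (max 1 (Suc n)))" by simp
  show "log_weight a (Suc n) \<le> log_weight a n" unfolding log_weight_def
    using powr_weight_bounds[of a n] assms pos[of n] ln_mono by (intro frac_le power_mono) auto
  \<comment> \<open>Passing from \<open>n\<close> to \<open>Suc n\<close> at most doubles the
    quantity \<open>1 + ln\<close>; squaring gives the extra factor 4 in the doubling
    constant.\<close>
  have "ln (real (max 1 (Suc n))) \<le> ln (2 * real (max 1 n))" by (subst ln_le_cancel_iff) auto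
  also have "\<dots> = ln 2 + ln (real (max 1 n))" by (subst ln_mult) auto
  also have "\<dots> \<le> 1 + 2 * ln (real (max 1 n))" using ln_le_minus_one[of 2] ln_nonneg[of n] by linarith
  finally have "(1 + ln (real (max 1 (Suc n))))\<^sup>2 \<le> (2 * (1 + ln (real (max 1 n))))\<^sup>2"
    using pos[of "Suc n"] by (intro power_mono) auto
  then have "(1 + ln (real (max 1 (Suc n))))\<^sup>2 \<le> 4 * (1 + ln (real (max 1 n)))\<^sup>2"
    unfolding power_mult_distrib by simp
  moreover have "powr_weight a n \<le> 2 powr (1 + a) * powr_weight a (Suc n)"
    using assms by (intro powr_weight_bounds) simp
  ultimately have "powr_weight a n * (1 + ln (real (max 1 (Suc n))))\<^sup>2 \<le>
      (2 powr (1 + a) * powr_weight a (Suc n)) * (4 * (1 + ln (real (max 1 n)))\<^sup>2)"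
    using powr_weight_bounds(1)[of a] assms by (intro mult_mono) (auto simp: less_imp_le)
  then show "log_weight a n \<le> 2 powr (1 + a) * 4 * log_weight a (Suc n)"
    using pos[of n] pos[of "Suc n"] unfolding log_weight_def by (simp add: field_simps)
next
  show "summable (\<lambda>n. log_weight a n * real n)"
    using summable_log_weight_iff[of a 1] assms by simp
qed

theorem theorem5p1p1:
  shows "(\<forall>(X :: 'a set) \<rho> \<mu>. mm_space X \<rho> \<mu> \<longrightarrow>
            (caseA X \<rho> \<mu> \<and> \<not> (\<exists>p0. caseB X \<rho> \<mu> p0) \<and> \<not> (\<exists>p0. caseC X \<rho> \<mu> p0)) \<or>
            (\<not> caseA X \<rho> \<mu> \<and> (\<exists>p0. caseB X \<rho> \<mu> p0) \<and> \<not> (\<exists>p0. caseC X \<rho> \<mu> p0)) \<or>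
            (\<not> caseA X \<rho> \<mu> \<and> \<not> (\<exists>p0. caseB X \<rho> \<mu> p0) \<and> (\<exists>p0. caseC X \<rho> \<mu> p0)))
       \<and> (\<exists>(X :: real set) \<rho> \<mu>. mm_space X \<rho> \<mu> \<and> caseA X \<rho> \<mu>)
       \<and> (\<forall>p0 > 1. \<exists>(X :: real set) \<rho> \<mu>. mm_space X \<rho> \<mu> \<and> caseB X \<rho> \<mu> p0)
       \<and> (\<forall>p0 \<ge> 1. \<exists>(X :: real set) \<rho> \<mu>. mm_space X \<rho> \<mu> \<and> caseC X \<rho> \<mu> p0)"
proof (intro conjI)
  show "\<forall>(X :: 'a set) \<rho> \<mu>. mm_space X \<rho> \<mu> \<longrightarrow>
            (caseA X \<rho> \<mu> \<and> \<not> (\<exists>p0. caseB X \<rho> \<mu> p0) \<and> \<not> (\<exists>p0. caseC X \<rho> \<mu> p0)) \<or>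
            (\<not> caseA X \<rho> \<mu> \<and> (\<exists>p0. caseB X \<rho> \<mu> p0) \<and> \<not> (\<exists>p0. caseC X \<rho> \<mu> p0)) \<or>
            (\<not> caseA X \<rho> \<mu> \<and> \<not> (\<exists>p0. caseB X \<rho> \<mu> p0) \<and> (\<exists>p0. caseC X \<rho> \<mu> p0))"
    by (intro allI impI BMO_trichotomy)
  have "caseA (range real) path_dist (path_measure (\<lambda>n. exp (- real n)))"
    unfolding caseA_iff
  proof (intro allI impI)
    fix p :: real assume "1 \<le> p"
    interpret path_weight "\<lambda>n. exp (- real n)" "exp 1" by (rule path_weight_exp)
    show "BMO X path_dist \<mu> p = BMO X path_dist \<mu> 1"
      using \<open>1 \<le> p\<close> by (simp add: BMO_eq_BMO_1_iff summable_exp_powr)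
  qed
  then show "\<exists>(X :: real set) \<rho> \<mu>. mm_space X \<rho> \<mu> \<and> caseA X \<rho> \<mu>"
    using mm_space_path by blast
  show "\<forall>p0 > 1. \<exists>(X :: real set) \<rho> \<mu>. mm_space X \<rho> \<mu> \<and> caseB X \<rho> \<mu> p0"
  proof (intro allI impI)
    fix p0 :: real assume p0: "1 < p0"
    interpret path_weight "powr_weight p0" "2 powr (1 + p0)" by (rule path_weight_powr[OF p0])
    have "caseB X path_dist \<mu> p0"
      unfolding caseB_iff[OF mm]
    proof (intro conjI allI impI p0)
      fix p :: real assume "1 < p"
      then show "BMO X path_dist \<mu> p = BMO X path_dist \<mu> 1 \<longleftrightarrow> p < p0"
        by (simp add: BMO_eq_BMO_1_iff powr_weight_mult_powr summable_real_powr_iff)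
    qed
    then show "\<exists>(X :: real set) \<rho> \<mu>. mm_space X \<rho> \<mu> \<and> caseB X \<rho> \<mu> p0" using mm by blast
  qed
  show "\<forall>p0 \<ge> 1. \<exists>(X :: real set) \<rho> \<mu>. mm_space X \<rho> \<mu> \<and> caseC X \<rho> \<mu> p0"
  proof (intro allI impI)
    fix p0 :: real assume p0: "1 \<le> p0"
    interpret path_weight "log_weight p0" "2 powr (1 + p0) * 4" by (rule path_weight_log[OF p0])
    have "caseC X path_dist \<mu> p0"
      unfolding caseC_iff[OF mm]
    proof (intro conjI allI impI p0)
      fix p :: real assume "1 < p"
      then show "BMO X path_dist \<mu> p = BMO X path_dist \<mu> 1 \<longleftrightarrow> p \<le> p0"
        by (simp add: BMO_eq_BMO_1_iff summable_log_weight_iff)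
    qed
    then show "\<exists>(X :: real set) \<rho> \<mu>. mm_space X \<rho> \<mu> \<and> caseC X \<rho> \<mu> p0" using mm by blast
  qed
qed

end
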